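(* The three-dimensional Anderson form $\mathfrak a$ defined in the context is closed, that is, $(\mathcal D(\mathfrak a),\|\cdot\|_{\mathfrak a})$ is a complete space.
   Context: $\mathbb T^3=(\mathbb R/2\pi\mathbb Z)^3$ is the torus with Lebesgue measure $\mathrm dx$, normalized to total mass $1$; functions are real-valued. $\mathcal H^1=\mathcal H^1(\mathbb T^3)$ is the usual Sobolev space. For $\alpha\in\mathbb R$, $\mathcal C^\alpha=\mathcal B^\alpha_{\infty,\infty}$ is the Besov–Hölder space with norm $\sup_{n\ge0}2^{\alpha n}\|\Delta_nu\|_{L^\infty}$, where $(\Delta_n)_{n\ge 0}$ are the Littlewood–Paley projectors. $\langle\cdot,\cdot\rangle$ is the duality bracket extending the $L^2$ inner product. White noise: $\xi=\sum_{k\in\mathbb Z^3}\xi_ke^{ik\cdot x}$, where the $\xi_k$ are independent and identically distributed centered standard complex Gaussian variables up to the constraint $\xi_{-k}=\overline{\xi_k}$; so $\mathbb E[\langle\xi,\varphi\rangle\langle\xi,\psi\rangle]=\langle\varphi,\psi\rangle_{L^2}$. The field $X(x)=-\sum_{k\ne0}|k|^{-2}\xi_ke^{ik\cdot x}$ satisfies $\Delta X=\xi-\xi_0$ and almost surely $X\in\mathcal C^{\frac12-\kappa}$ for every $\kappa>0$. Let $\rho_\varepsilon$ be a mollifier, $\xi_\varepsilon=\xi*\rho_\varepsilon$, $X_\varepsilon=X*\rho_\varepsilon$ (so $\Delta X_\varepsilon=\xi_\varepsilon-\langle\xi_\varepsilon,1\rangle$). Renormalized products (limits as $\varepsilon\to0$,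 for every $\kappa>0$): $|\nabla X|^{2\diamond}=\lim(|\nabla X_\varepsilon|^2-\mathbb E[|\nabla X_\varepsilon|^2])$ in $\mathcal C^{-1-2\kappa}(\mathbb T^3)$ in probability; $Y$ and $Y_\varepsilon$ are the mean-zero solutions of $$\Delta Y=|\nabla X|^{2\diamond}-\langle|\nabla X|^{2\diamond},1\rangle,\qquad \Delta Y_\varepsilon=|\nabla X_\varepsilon|^2-\langle|\nabla X_\varepsilon|^2,1\rangle,$$ and $Y\in\mathcal C^{1-\kappa}$ for every $\kappa>0$; $|\nabla Y|^{2\diamond}=\lim(|\nabla Y_\varepsilon|^2-\mathbb E[|\nabla Y_\varepsilon|^2])$ in $\mathcal C^{-4\kappa}(\mathbb T^3)$ in probability; $\nabla X\diamond\nabla Y=\lim\nabla X_\varepsilon\cdot\nabla Y_\varepsilon$, which belongs to $\mathcal C^{-\frac12-3\kappa}(\mathbb T^3)$. The three-dimensional Anderson form is $$\mathfrak a(u_1,u_2):=\langle\nabla v_1,\nabla v_2\rangle_{L^2(\mathbb T^3,e^{2X+2Y}\mathrm dx)}-\big\langle|\nabla Y|^{2\diamond}+2\nabla X\diamond\nabla Y,\,v_1v_2e^{2X+2Y}\big\rangle+\big(\langle|\nabla X|^{2\diamond},1\rangle+\xi_0\big)\langle v_1,v_2\rangle_{L^2(\mathbb T^3,e^{2X+2Y}\mathrm dx)},$$ where $v_i=e^{-(X+Y)}u_i$, with (random) domain $\mathcal D(\mathfrak a):=e^{X+Y}\mathcal H^1(\mathbb T^3)$ and norm $\|u\|_{\mathfrak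 a}^2:=\|u\|_{L^2}^2+\|e^{-(X+Y)}u\|_{\mathcal H^1}^2$. The form is taken to be well-defined for $v_1,v_2\in\mathcal H^1$, on the grounds that $|\nabla Y|^{2\diamond}\in\mathcal C^{-\kappa}$ and $\nabla X\diamond\nabla Y\in\mathcal C^{-\frac12-\kappa}$ for any $\kappa>0$. *)

theory Defs
  imports "HOL-Probability.Probability"
begin

section \<open>Functions and distributions on the torus\<close>

text \<open>
  The torus is represented by its fundamental cell: \<open>torus\<close> is Lebesgue measure on the cube of
  side \<open>2 * pi\<close>, normalized to total mass 1.  Functions on the torus are Borel functions
  \<open>real^3 \<Rightarrow> real\<close>, of which only the values on the cell matter, up to null sets.
  A distribution on the torus is represented by its sequence of Fourier coefficients
  \<open>int^3 \<Rightarrow> complex\<close>; a function \<open>f\<close> is seen as the distribution \<open>fcoeff f\<close>, and Fourier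
  multipliers (derivatives, mollification, Littlewood--Paley projectors) act coefficientwise.
\<close>

definition torus :: "(real^3) measure" where
  "torus = uniform_measure lborel (cbox 0 (\<chi> i. 2 * pi))"

type_synonym distr3 = "int^3 \<Rightarrow> complex"

definition freq :: "int^3 \<Rightarrow> real^3" where
  "freq k = (\<chi> i. real_of_int (k $ i))"

definition fcoeff :: "(real^3 \<Rightarrow> real) \<Rightarrow> distr3" where
  "fcoeff f k = (LINT x|torus. complex_of_real (f x) * cis (- (freq k \<bullet> x)))"

text \<open>The Fourier series of a distribution; only used when it converges absolutely.\<close>

definition fseries :: "distr3 \<Rightarrow> real^3 \<Rightarrow> complex" where
  "fseries T x = (\<Sum>\<^sub>\<infinity>k\<in>UNIV. T k * cis (freq k \<bullet> x))"

definition dpartial :: "3 \<Rightarrow> distr3 \<Rightarrow> distr3" where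
  "dpartial j T k = \<i> * of_int (k $ j) * T k"

definition laplacian :: "distr3 \<Rightarrow> distr3" where
  "laplacian T k = (\<Sum>j\<in>UNIV. dpartial j (dpartial j T) k)"

text \<open>\<open>\<langle>T, 1\<rangle>\<close> is the zeroth Fourier coefficient, and \<open>const_distr c\<close> is the constant function \<open>c\<close>.\<close>

definition const_distr :: "complex \<Rightarrow> distr3" where
  "const_distr c k = (if k = 0 then c else 0)"

definition mean_zero_solution :: "distr3 \<Rightarrow> distr3 \<Rightarrow> bool" where
  "mean_zero_solution F Y \<longleftrightarrow> Y 0 = 0 \<and> laplacian Y = (\<lambda>k. F k - const_distr (F 0) k)"

definition poisson :: "distr3 \<Rightarrow> distr3" where
  "poisson F = (THE Y. mean_zero_solution F Y)"

lemma laplacian_eq: "laplacian T k = - of_real ((norm (freq k))\<^sup>2) * T k"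
proof -
  have "dpartial j (dpartial j T) k = - of_real (freq k $ j * freq k $ j) * T k" for j
  proof -
    have "dpartial j (dpartial j T) k = (\<i> * \<i>) * (of_int (k $ j) * of_int (k $ j)) * T k"
      unfolding dpartial_def by (simp only: mult_ac)
    then show ?thesis by (simp add: freq_def)
  qed
  then have "laplacian T k = (\<Sum>j\<in>UNIV. - of_real (freq k $ j * freq k $ j) * T k)"
    unfolding laplacian_def by simp
  also have "\<dots> = - of_real (freq k \<bullet> freq k) * T k"
    by (simp add: inner_vec_def sum_negf flip: sum_distrib_right)
  finally show ?thesis by (simp add: dot_square_norm)
qed

lemma freq_eq_0_iff: "freq k = 0 \<longleftrightarrow> k = 0"
  by (auto simp: freq_def vec_eq_iff)

lemma mean_zero_solution_iff:
  "mean_zero_solution F Y \<longleftrightarrow>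
     Y = (\<lambda>k. if k = 0 then 0 else - F k / of_real ((norm (freq k))\<^sup>2))"
proof -
  have eq: "- of_real r * y = f \<longleftrightarrow> y = - f / of_real r" if "r \<noteq> 0" for r :: real and y f :: complex
    using that by (metis eq_divide_eq minus_minus mult.commute mult_minus_left of_real_eq_0_iff)
  have "laplacian Y k = F k - const_distr (F 0) k \<longleftrightarrow>
          (k \<noteq> 0 \<longrightarrow> Y k = - F k / of_real ((norm (freq k))\<^sup>2))" for k
  proof (cases "k = 0")
    case True
    then show ?thesis using freq_eq_0_iff[of 0] by (simp add: laplacian_eq const_distr_def)
  next
    case False
    then have "(norm (freq k))\<^sup>2 \<noteq> 0" by (simp add: freq_eq_0_iff)
    from eq[OF this] False show ?thesis unfolding laplacian_eq const_distr_def by simp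
  qed
  then show ?thesis unfolding mean_zero_solution_def fun_eq_iff by (metis (full_types))
qed

lemma poisson_eq:
  "poisson F = (\<lambda>k. if k = 0 then 0 else - F k / of_real ((norm (freq k))\<^sup>2))"
  unfolding poisson_def mean_zero_solution_iff by simp


section \<open>Smooth functions, mollifiers and dyadic partitions of unity\<close>

text \<open>\<open>D [i, j, \<dots>]\<close> is the iterated partial derivative of \<open>f\<close> in the directions \<open>i, j, \<dots>\<close>.\<close>

definition smooth :: "(real^3 \<Rightarrow> real) \<Rightarrow> bool" where
  "smooth f \<longleftrightarrow> (\<exists>D :: 3 list \<Rightarrow> real^3 \<Rightarrow> real. D [] = f \<and>
     (\<forall>is x. (D is has_derivative (\<lambda>h. \<Sum>j\<in>UNIV. h $ j * D (j # is) x)) (at x)))"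

definition mollifier :: "(real^3 \<Rightarrow> real) \<Rightarrow> bool" where
  "mollifier \<rho> \<longleftrightarrow> smooth \<rho> \<and> bounded {x. \<rho> x \<noteq> 0} \<and> integral\<^sup>L lborel \<rho> = 1"

definition rescale :: "(real^3 \<Rightarrow> real) \<Rightarrow> real \<Rightarrow> real^3 \<Rightarrow> real" where
  "rescale \<rho> \<epsilon> y = \<rho> (y /\<^sub>R \<epsilon>) / \<epsilon> ^ 3"

text \<open>
  \<open>mollify \<rho> \<epsilon> T\<close> is \<open>T * \<rho>\<^sub>\<epsilon>\<close>, the convolution over \<open>real^3\<close> of the periodic
  distribution \<open>T\<close> with \<open>\<rho>\<^sub>\<epsilon>\<close>; its Fourier coefficients are those of \<open>T\<close> times the Fourier
  transform of \<open>\<rho>\<^sub>\<epsilon>\<close>.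
\<close>

definition mollify :: "(real^3 \<Rightarrow> real) \<Rightarrow> real \<Rightarrow> distr3 \<Rightarrow> distr3" where
  "mollify \<rho> \<epsilon> T k =
     T k * (LINT y|lborel. complex_of_real (rescale \<rho> \<epsilon> y) * cis (- (freq k \<bullet> y)))"

definition dyadic_partition :: "(real^3 \<Rightarrow> real) \<Rightarrow> (real^3 \<Rightarrow> real) \<Rightarrow> bool" where
  "dyadic_partition \<theta> \<phi> \<longleftrightarrow>
     smooth \<theta> \<and> smooth \<phi> \<and>
     (\<forall>z. 0 \<le> \<theta> z \<and> \<theta> z \<le> 1 \<and> 0 \<le> \<phi> z \<and> \<phi> z \<le> 1) \<and>
     (\<forall>z w. norm z = norm w \<longrightarrow> \<theta> z = \<theta> w \<and> \<phi> z = \<phi> w) \<and>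
     (\<forall>z. \<theta> z \<noteq> 0 \<longrightarrow> norm z \<le> 4 / 3) \<and>
     (\<forall>z. \<phi> z \<noteq> 0 \<longrightarrow> 3 / 4 \<le> norm z \<and> norm z \<le> 8 / 3) \<and>
     (\<forall>z. (\<lambda>n. \<phi> (z /\<^sub>R 2 ^ n)) sums (1 - \<theta> z))"


section \<open>Littlewood--Paley projectors and Besov--Hoelder spaces\<close>

text \<open>The low-frequency block has index 0, so that the annulus of the block \<open>n \<ge> 1\<close> is
  \<open>2 ^ (n - 1)\<close> times the support of \<open>\<phi>\<close>.\<close>

definition lp_symbol :: "(real^3 \<Rightarrow> real) \<Rightarrow> (real^3 \<Rightarrow> real) \<Rightarrow> nat \<Rightarrow> real^3 \<Rightarrow> real" where
  "lp_symbol \<theta> \<phi> n z = (case n of 0 \<Rightarrow> \<theta> z | Suc m \<Rightarrow> \<phi> (z /\<^sub>R 2 ^ m))"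

definition lp_block ::
  "(real^3 \<Rightarrow> real) \<Rightarrow> (real^3 \<Rightarrow> real) \<Rightarrow> nat \<Rightarrow> distr3 \<Rightarrow> real^3 \<Rightarrow> complex" where
  "lp_block \<theta> \<phi> n T = fseries (\<lambda>k. of_real (lp_symbol \<theta> \<phi> n (freq k)) * T k)"

text \<open>The blocks are trigonometric polynomials, so the supremum is the \<open>L\<^sup>\<infinity>\<close> norm.\<close>

definition besov_norm ::
  "(real^3 \<Rightarrow> real) \<Rightarrow> (real^3 \<Rightarrow> real) \<Rightarrow> real \<Rightarrow> distr3 \<Rightarrow> ennreal" where
  "besov_norm \<theta> \<phi> \<alpha> T =
     (SUP n. ennreal (2 powr (\<alpha> * real n)) * (SUP x. ennreal (norm (lp_block \<theta> \<phi> n T x))))"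

definition besov :: "(real^3 \<Rightarrow> real) \<Rightarrow> (real^3 \<Rightarrow> real) \<Rightarrow> real \<Rightarrow> distr3 set" where
  "besov \<theta> \<phi> \<alpha> = {T. besov_norm \<theta> \<phi> \<alpha> T < \<infinity>}"

text \<open>
  The continuous function which a real distribution of positive regularity is; the sum of the
  Littlewood--Paley blocks then converges uniformly.
\<close>

definition lp_fun :: "(real^3 \<Rightarrow> real) \<Rightarrow> (real^3 \<Rightarrow> real) \<Rightarrow> distr3 \<Rightarrow> real^3 \<Rightarrow> real" where
  "lp_fun \<theta> \<phi> T x = Re (\<Sum>n. lp_block \<theta> \<phi> n T x)"

text \<open>
  The duality bracket between a real distribution and a function, extended from the \<open>L\<^sup>2\<close>
  inner product along the Littlewood--Paley decomposition of the distribution.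
  The value is meaningful only if the limit exists.
\<close>

definition bracket ::
  "(real^3 \<Rightarrow> real) \<Rightarrow> (real^3 \<Rightarrow> real) \<Rightarrow> distr3 \<Rightarrow> (real^3 \<Rightarrow> real) \<Rightarrow> real" where
  "bracket \<theta> \<phi> T f =
     lim (\<lambda>N. LINT x|torus. Re (\<Sum>n\<le>N. lp_block \<theta> \<phi> n T x) * f x)"


section \<open>The spaces \<open>L\<^sup>2\<close> and \<open>H\<^sup>1\<close>\<close>

definition L2 :: "(real^3 \<Rightarrow> real) set" where
  "L2 = {u \<in> borel_measurable borel. integrable torus (\<lambda>x. (u x)\<^sup>2)}"

definition L2_norm :: "(real^3 \<Rightarrow> real) \<Rightarrow> real" where
  "L2_norm u = sqrt (LINT x|torus. (u x)\<^sup>2)"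

definition is_weak_partial :: "3 \<Rightarrow> (real^3 \<Rightarrow> real) \<Rightarrow> (real^3 \<Rightarrow> real) \<Rightarrow> bool" where
  "is_weak_partial j u g \<longleftrightarrow> g \<in> L2 \<and> fcoeff g = dpartial j (fcoeff u)"

definition H1 :: "(real^3 \<Rightarrow> real) set" where
  "H1 = {u \<in> L2. \<forall>j. \<exists>g. is_weak_partial j u g}"

definition weak_partial :: "3 \<Rightarrow> (real^3 \<Rightarrow> real) \<Rightarrow> real^3 \<Rightarrow> real" where
  "weak_partial j u = (SOME g. is_weak_partial j u g)"

definition H1_norm :: "(real^3 \<Rightarrow> real) \<Rightarrow> real" where
  "H1_norm u = sqrt ((L2_norm u)\<^sup>2 + (\<Sum>j\<in>UNIV. (L2_norm (weak_partial j u))\<^sup>2))"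


section \<open>White noise and the renormalized products\<close>

text \<open>One representative of each pair \<open>{k, - k}\<close> with \<open>k \<noteq> 0\<close>.\<close>

definition half_lattice :: "(int^3) set" where
  "half_lattice = {k. k $ 1 > 0 \<or> (k $ 1 = 0 \<and> k $ 2 > 0) \<or>
                      (k $ 1 = 0 \<and> k $ 2 = 0 \<and> k $ 3 > 0)}"

text \<open>
  The Fourier coefficients of white noise.  The constraint makes \<open>\<xi> 0\<close> a real Gaussian of
  variance 1; for \<open>k \<noteq> 0\<close> the real and imaginary parts each have variance 1/2, so that
  \<open>E |\<xi> k|\<^sup>2 = 1\<close>.
\<close>

definition white_noise :: "'w measure \<Rightarrow> (int^3 \<Rightarrow> 'w \<Rightarrow> complex) \<Rightarrow> bool" where
  "white_noise M \<xi> \<longleftrightarrow>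
     (\<forall>k. \<forall>\<omega>\<in>space M. \<xi> (- k) \<omega> = cnj (\<xi> k \<omega>)) \<and>
     prob_space.indep_vars M (\<lambda>_. borel) \<xi> (insert 0 half_lattice) \<and>
     distributed M lborel (\<lambda>\<omega>. Re (\<xi> 0 \<omega>)) (normal_density 0 1) \<and>
     (\<forall>k\<in>half_lattice.
        prob_space.indep_var M borel (\<lambda>\<omega>. Re (\<xi> k \<omega>)) borel (\<lambda>\<omega>. Im (\<xi> k \<omega>)) \<and>
        distributed M lborel (\<lambda>\<omega>. Re (\<xi> k \<omega>)) (normal_density 0 (1 / sqrt 2)) \<and>
        distributed M lborel (\<lambda>\<omega>. Im (\<xi> k \<omega>)) (normal_density 0 (1 / sqrt 2)))"

definition X_field :: "(int^3 \<Rightarrow> 'w \<Rightarrow> complex) \<Rightarrow> 'w \<Rightarrow> distr3" where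
  "X_field \<xi> \<omega> k = (if k = 0 then 0 else - \<xi> k \<omega> / of_real ((norm (freq k))\<^sup>2))"

definition grad_dot :: "distr3 \<Rightarrow> distr3 \<Rightarrow> real^3 \<Rightarrow> real" where
  "grad_dot S T x =
     (\<Sum>j\<in>UNIV. Re (fseries (dpartial j S) x) * Re (fseries (dpartial j T) x))"

definition X_eps ::
  "(real^3 \<Rightarrow> real) \<Rightarrow> (int^3 \<Rightarrow> 'w \<Rightarrow> complex) \<Rightarrow> real \<Rightarrow> 'w \<Rightarrow> distr3" where
  "X_eps \<rho> \<xi> \<epsilon> \<omega> = mollify \<rho> \<epsilon> (X_field \<xi> \<omega>)"

definition Y_eps ::
  "(real^3 \<Rightarrow> real) \<Rightarrow> (int^3 \<Rightarrow> 'w \<Rightarrow> complex) \<Rightarrow> real \<Rightarrow> 'w \<Rightarrow> distr3" where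
  "Y_eps \<rho> \<xi> \<epsilon> \<omega> = poisson (fcoeff (grad_dot (X_eps \<rho> \<xi> \<epsilon> \<omega>) (X_eps \<rho> \<xi> \<epsilon> \<omega>)))"

text \<open>\<open>|\<nabla>T|\<^sup>2 - E[|\<nabla>T|\<^sup>2]\<close> for a smooth random field \<open>T\<close>\<close>

definition centered_grad_sq :: "'w measure \<Rightarrow> ('w \<Rightarrow> distr3) \<Rightarrow> 'w \<Rightarrow> distr3" where
  "centered_grad_sq M T \<omega> =
     fcoeff (\<lambda>x. grad_dot (T \<omega>) (T \<omega>) x - (LINT \<omega>'|M. grad_dot (T \<omega>') (T \<omega>') x))"

text \<open>
  Convergence in probability, as \<open>\<epsilon>\<close> decreases to 0, in the Besov--Hoelder space of exponent
  \<open>\<alpha>\<close>.  The bad event is bounded by a measurable one, so that no measurability of the norm is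
  presupposed.
\<close>

definition besov_limit_in_prob ::
  "(real^3 \<Rightarrow> real) \<Rightarrow> (real^3 \<Rightarrow> real) \<Rightarrow> 'w measure \<Rightarrow> real \<Rightarrow>
     (real \<Rightarrow> 'w \<Rightarrow> distr3) \<Rightarrow> ('w \<Rightarrow> distr3) \<Rightarrow> bool" where
  "besov_limit_in_prob \<theta> \<phi> M \<alpha> A B \<longleftrightarrow>
     (AE \<omega> in M. B \<omega> \<in> besov \<theta> \<phi> \<alpha>) \<and>
     (\<forall>\<delta>>0. \<forall>\<eta>>0. \<forall>\<^sub>F \<epsilon> in at_right 0. \<exists>E\<in>sets M. measure M E < \<eta> \<and>
        {\<omega>\<in>space M. besov_norm \<theta> \<phi> \<alpha> (\<lambda>k. A \<epsilon> \<omega> k - B \<omega> k) > ennreal \<delta>} \<subseteq> E)"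


section \<open>Closed forms and the Anderson form\<close>

text \<open>A bilinear form on a space of functions, with its domain and the norm of the domain.\<close>

record normed_form =
  form_dom :: "(real^3 \<Rightarrow> real) set"
  form_val :: "(real^3 \<Rightarrow> real) \<Rightarrow> (real^3 \<Rightarrow> real) \<Rightarrow> real"
  form_norm :: "(real^3 \<Rightarrow> real) \<Rightarrow> real"

definition ae_class :: "(real^3 \<Rightarrow> real) \<Rightarrow> (real^3 \<Rightarrow> real) set" where
  "ae_class u = {w \<in> borel_measurable borel. AE x in torus. w x = u x}"

definition ae_rep :: "(real^3 \<Rightarrow> real) set \<Rightarrow> real^3 \<Rightarrow> real" where
  "ae_rep A = (SOME u. u \<in> A)"

text \<open>
  Functions equal almost everywhere are identified, and completeness is that of the metric
  \<open>\<parallel>u - v\<parallel>\<close> on the resulting set of classes.  The inclusion in \<open>L\<^sup>2\<close> makes the \<open>L\<^sup>2\<close> norm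
  of an element of the domain meaningful (the Bochner integral of a non-integrable function
  being 0).
\<close>

definition closed_form :: "normed_form \<Rightarrow> bool" where
  "closed_form F \<longleftrightarrow>
     form_dom F \<subseteq> L2 \<and>
     (let C = ae_class ` form_dom F;
          d = (\<lambda>A B. form_norm F (\<lambda>x. ae_rep A x - ae_rep B x))
      in Metric_space C d \<and> Metric_space.mcomplete C d)"

text \<open>
  \<open>W\<close> is the function \<open>X + Y\<close>.  The arguments \<open>xi0\<close>, \<open>XX\<close>, \<open>YY\<close>, \<open>XY\<close> stand for
  \<open>\<xi>\<^sub>0\<close>, \<open>|\<nabla>X|\<^sup>2\<close>, \<open>|\<nabla>Y|\<^sup>2\<close> and \<open>\<nabla>X \<cdot> \<nabla>Y\<close> (renormalized).
\<close>

definition anderson_val ::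
  "(real^3 \<Rightarrow> real) \<Rightarrow> (real^3 \<Rightarrow> real) \<Rightarrow> (real^3 \<Rightarrow> real) \<Rightarrow> real \<Rightarrow>
     distr3 \<Rightarrow> distr3 \<Rightarrow> distr3 \<Rightarrow> (real^3 \<Rightarrow> real) \<Rightarrow> (real^3 \<Rightarrow> real) \<Rightarrow> real" where
  "anderson_val \<theta> \<phi> W xi0 XX YY XY u1 u2 =
     (let v1 = (\<lambda>x. exp (- W x) * u1 x);
          v2 = (\<lambda>x. exp (- W x) * u2 x)
      in (LINT x|torus. (\<Sum>j\<in>UNIV. weak_partial j v1 x * weak_partial j v2 x) * exp (2 * W x))
         - bracket \<theta> \<phi> (\<lambda>k. YY k + 2 * XY k) (\<lambda>x. v1 x * v2 x * exp (2 * W x))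
         + (bracket \<theta> \<phi> XX (\<lambda>_. 1) + xi0) * (LINT x|torus. v1 x * v2 x * exp (2 * W x)))"

definition anderson_form ::
  "(real^3 \<Rightarrow> real) \<Rightarrow> (real^3 \<Rightarrow> real) \<Rightarrow> distr3 \<Rightarrow> real \<Rightarrow>
     distr3 \<Rightarrow> distr3 \<Rightarrow> distr3 \<Rightarrow> normed_form" where
  "anderson_form \<theta> \<phi> X xi0 XX YY XY =
     (let W = (\<lambda>x. lp_fun \<theta> \<phi> X x + lp_fun \<theta> \<phi> (poisson XX) x)
      in \<lparr>form_dom = (\<lambda>v x. exp (W x) * v x) ` H1,
          form_val = anderson_val \<theta> \<phi> W xi0 XX YY XY,
          form_norm = (\<lambda>u. sqrt ((L2_norm u)\<^sup>2 + (H1_norm (\<lambda>x. exp (- W x) * u x))\<^sup>2))\<rparr>)"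

end

(*
  Multiplication by e^(-(X+Y)) is a bijection of the domain onto H^1, and X + Y, having positive
  Hoelder regularity, is continuous and bounded.  Hence the L^2 part of the form norm is controlled
  by the H^1 part, and closedness is the completeness of H^1.  The latter follows from the
  completeness of L^2, weak derivatives passing to L^2 limits Fourier coefficient by Fourier
  coefficient.  Weak derivatives are defined through Fourier coefficients, so that their
  uniqueness, already needed for the triangle inequality, is the uniqueness theorem for Fourier
  series, which comes from Stone-Weierstrass.
*)

theory Submission
  imports Defs
begin

text \<open>Fourier coefficients see the torus, whereas functions and Borel sets live on the cube,
  whose opposite faces the torus identifies. Uniqueness is therefore settled on the compact image of
  the cube in \<open>complex^3\<close>: continuous functions are approximated there, and sets are
  carried back to the open cube, whose boundary is null. Trigonometric polynomials are never written
  out. The approximants are the functions whose product with any integrable function without Fourier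
  coefficients is again of that kind; closure under sums and products and the coordinate functions
  suffice. The other obstacle is that nothing is canonical: weak derivatives are chosen
  representatives, and the metric lives on almost-everywhere classes and is evaluated on further
  chosen representatives. Each choice is neutralized by invariance under almost-everywhere equality.
  Probability enters only at the end, where a deterministic statement is applied to each sample for
  which X and Y have positive regularity.\<close>

section \<open>Normalized Lebesgue measure on the cell\<close>

lemma sets_torus [measurable_cong, simp]: "sets torus = sets borel"
  by (simp add: torus_def)

lemma space_torus [simp]: "space torus = UNIV"
  by (simp add: torus_def)

text \<open>The closed cell gives the normalization; that the open one has the same volume makes the
  faces null.\<close>

lemma emeasure_cell:
  "emeasure lborel (cbox 0 (\<chi> i. 2 * pi) :: (real^3) set) = ennreal ((2 * pi) ^ 3)"
  "emeasure lborel (box 0 (\<chi> i. 2 * pi) :: (real^3) set) = ennreal ((2 * pi) ^ 3)"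
proof -
  have "(\<Prod>b\<in>Basis. ((\<chi> i. 2 * pi) - (0::real^3)) \<bullet> b) = (\<Prod>b\<in>(Basis::(real^3) set). 2 * pi)"
    by (intro prod.cong refl) (auto simp: Basis_vec_def inner_axis)
  then have *: "(\<Prod>b\<in>Basis. ((\<chi> i. 2 * pi) - (0::real^3)) \<bullet> b) = (2 * pi) ^ 3"
    by (simp del: power_mult_distrib)
  have le: "(0::real^3) \<bullet> b \<le> (\<chi> i. 2 * pi) \<bullet> b" if "b \<in> Basis" for b
    using that by (auto simp: Basis_vec_def inner_axis)
  show "emeasure lborel (cbox 0 (\<chi> i. 2 * pi) :: (real^3) set) = ennreal ((2 * pi) ^ 3)"
    "emeasure lborel (box 0 (\<chi> i. 2 * pi) :: (real^3) set) = ennreal ((2 * pi) ^ 3)"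
    using le by (simp_all only: emeasure_lborel_cbox_eq emeasure_lborel_box_eq * ) auto
qed

interpretation torus: prob_space torus
  unfolding torus_def by (rule prob_space_uniform_measure) (simp_all add: emeasure_cell)

lemma AE_torus_interior: "AE x in torus. x \<in> box 0 (\<chi> i. 2 * pi)"
  unfolding torus_def
proof (rule AE_uniform_measureI)
  have "emeasure lborel (cbox 0 (\<chi> i. 2 * pi) - box 0 (\<chi> i. 2 * pi) :: (real^3) set) = 0"
    by (subst emeasure_Diff) (auto simp: emeasure_cell box_subset_cbox)
  then have "AE x::real^3 in lborel. x \<notin> cbox 0 (\<chi> i. 2 * pi) - box 0 (\<chi> i. 2 * pi)"
    by (intro AE_not_in) (auto simp: null_sets_def)
  then show "AE x in lborel. x \<in> cbox 0 (\<chi> i. 2 * pi) \<longrightarrow> x \<in> (box 0 (\<chi> i. 2 * pi) :: (real^3) set)"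
    by eventually_elim auto
qed simp

section \<open>Uniqueness of Fourier coefficients\<close>

text \<open>The torus as a compact subset of \<open>complex^3\<close>, on which polynomials separate points.\<close>

definition torus_embed :: "real^3 \<Rightarrow> complex^3" where
  "torus_embed x = (\<chi> j. cis (x $ j))"

lemma continuous_on_torus_embed: "continuous_on A torus_embed"
  unfolding torus_embed_def by (intro continuous_intros)

lemma measurable_torus_embed [measurable]: "torus_embed \<in> borel_measurable borel"
  by (intro borel_measurable_continuous_onI continuous_on_torus_embed)

text \<open>The purpose is compactness, which Stone-Weierstrass requires: every angle has a
  representative in [0, 2 pi], so a compact cell already fills the range.\<close>

lemma range_torus_embed: "range torus_embed = torus_embed ` cbox 0 (\<chi> i. 2 * pi)"
proof -
  have "\<exists>y\<in>cbox 0 (\<chi> i. 2 * pi). torus_embed x = torus_embed y" for x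
  proof -
    have "\<exists>t. 0 \<le> t \<and> t \<le> 2 * pi \<and> cis (x $ j) = cis t" for j
      using sincos_total_2pi_le[of "cos (x $ j)" "sin (x $ j)"] by (auto simp: complex_eq_iff)
    then obtain t where "\<And>j. 0 \<le> t j \<and> t j \<le> 2 * pi \<and> cis (x $ j) = cis (t j)"
      by metis
    then show ?thesis
      by (intro bexI[of _ "\<chi> j. t j"]) (auto simp: torus_embed_def mem_box_cart)
  qed
  then show ?thesis by (auto simp: image_iff)
qed

lemma compact_range_torus_embed: "compact (range torus_embed)"
  unfolding range_torus_embed
  by (intro compact_continuous_image continuous_on_torus_embed compact_cbox)

text \<open>Angles with equal sine and cosine differ by a multiple of 2 pi, and inside the open cell
  the difference is smaller than 2 pi. On the closed cell opposite faces would collide.\<close>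

lemma inj_on_torus_embed: "inj_on torus_embed (box 0 (\<chi> i. 2 * pi))"
proof (rule inj_onI)
  fix x y :: "real^3"
  assume xy: "x \<in> box 0 (\<chi> i. 2 * pi)" "y \<in> box 0 (\<chi> i. 2 * pi)"
    and eq: "torus_embed x = torus_embed y"
  have "x $ j = y $ j" for j
  proof -
    have "cis (x $ j) = cis (y $ j)"
      using eq by (auto simp: torus_embed_def vec_eq_iff)
    then have "sin (x $ j) = sin (y $ j) \<and> cos (x $ j) = cos (y $ j)"
      by (simp add: complex_eq_iff)
    then obtain n :: int where n: "x $ j = y $ j + 2 * pi * n"
      using sin_cos_eq_iff by blast
    have "0 < x $ j" "x $ j < 2 * pi" "0 < y $ j" "y $ j < 2 * pi"
      using xy by (auto simp: mem_box_cart)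
    then have "\<bar>2 * pi * real_of_int n\<bar> < 2 * pi * 1"
      unfolding abs_less_iff using n by linarith
    then have "\<bar>real_of_int n\<bar> < 1"
      by (simp add: abs_mult)
    then show ?thesis using n by simp
  qed
  then show "x = y" by (simp add: vec_eq_iff)
qed

text \<open>
  The functions multiplication by which preserves the vanishing of all Fourier
  coefficients form an algebra, which contains the coordinates of \<open>torus_embed\<close>.
\<close>

definition fourier_null :: "(real^3 \<Rightarrow> complex) \<Rightarrow> bool" where
  "fourier_null f \<longleftrightarrow> integrable torus f \<and> (\<forall>k. (LINT x|torus. f x * cis (- (freq k \<bullet> x))) = 0)"

definition fourier_multiplier :: "(real^3 \<Rightarrow> complex) \<Rightarrow> bool" where
  "fourier_multiplier h \<longleftrightarrow> (\<forall>f. fourier_null f \<longrightarrow> fourier_null (\<lambda>x. h x * f x))"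

lemma continuous_on_cis_freq: "continuous_on A (\<lambda>x. cis (- (freq k \<bullet> x)))"
  by (intro continuous_intros)

lemma measurable_cis_freq [measurable]: "(\<lambda>x. cis (- (freq k \<bullet> x))) \<in> borel_measurable borel"
  by (intro borel_measurable_continuous_onI continuous_on_cis_freq)

lemma integrable_mult_cis:
  assumes "integrable torus f"
  shows "integrable torus (\<lambda>x. (f x :: complex) * cis (- (freq k \<bullet> x)))"
  using assms by (rule Bochner_Integration.integrable_bound)
    (use borel_measurable_integrable[OF assms] in \<open>auto simp: norm_mult\<close>)

lemma fourier_null_add:
  "fourier_null f \<Longrightarrow> fourier_null g \<Longrightarrow> fourier_null (\<lambda>x. f x + g x)"
  by (auto simp: fourier_null_def distrib_right integrable_mult_cis)

lemma fourier_null_cmult: "fourier_null f \<Longrightarrow> fourier_null (\<lambda>x. c * f x)"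
  by (auto simp: fourier_null_def mult.assoc)

lemma fourier_multiplier_add:
  "fourier_multiplier g \<Longrightarrow> fourier_multiplier h \<Longrightarrow> fourier_multiplier (\<lambda>x. g x + h x)"
  by (auto simp: fourier_multiplier_def distrib_right fourier_null_add)

lemma fourier_multiplier_mult:
  "fourier_multiplier g \<Longrightarrow> fourier_multiplier h \<Longrightarrow> fourier_multiplier (\<lambda>x. g x * h x)"
  by (auto simp: fourier_multiplier_def mult.assoc)

lemma fourier_multiplier_const: "fourier_multiplier (\<lambda>x. c)"
  by (auto simp: fourier_multiplier_def fourier_null_cmult)

text \<open>A character merely shifts the Fourier coefficients. Hence their vanishing at all
  frequencies is preserved, whereas a vanishing mean alone would not be.\<close>

lemma fourier_multiplier_cis: "fourier_multiplier (\<lambda>x. cis (- (freq m \<bullet> x)))"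
  unfolding fourier_multiplier_def
proof (intro allI impI)
  fix f assume f: "fourier_null f"
  have "(LINT x|torus. cis (- (freq m \<bullet> x)) * f x * cis (- (freq k \<bullet> x))) =
      (LINT x|torus. f x * cis (- (freq (k - - m) \<bullet> x)))" for k
  proof (rule Bochner_Integration.integral_cong)
    fix x
    have "freq (k - - m) = freq m + freq k"
      by (simp add: freq_def vec_eq_iff)
    then show "cis (- (freq m \<bullet> x)) * f x * cis (- (freq k \<bullet> x)) = f x * cis (- (freq (k - - m) \<bullet> x))"
      by (simp add: cis_mult inner_add_left algebra_simps)
  qed simp
  then show "fourier_null (\<lambda>x. cis (- (freq m \<bullet> x)) * f x)"
    using f integrable_mult_cis[of f m] by (auto simp: fourier_null_def mult.commute)
qed

lemma freq_axis: "freq (axis j c) \<bullet> x = of_int c * x $ j"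
proof -
  have "freq (axis j c) = axis j (real_of_int c)"
    by (auto simp: freq_def axis_def vec_eq_iff)
  then show ?thesis by (simp add: inner_axis' )
qed

text \<open>Euler's formula. Cosine and sine of a coordinate are the real and imaginary parts of a
  component of \<open>torus_embed\<close>, and these parts separate the points of its range.\<close>

lemma fourier_multiplier_cos: "fourier_multiplier (\<lambda>x. complex_of_real (cos (x $ j)))"
proof -
  have "complex_of_real (cos (x $ j)) =
      1 / 2 * cis (- (freq (axis j 1) \<bullet> x)) + 1 / 2 * cis (- (freq (axis j (- 1)) \<bullet> x))" for x :: "real^3"
    by (simp add: freq_axis complex_eq_iff)
  then show ?thesis
    by (simp only:) (intro fourier_multiplier_add fourier_multiplier_mult
        fourier_multiplier_const fourier_multiplier_cis)
qed

lemma fourier_multiplier_sin: "fourier_multiplier (\<lambda>x. complex_of_real (sin (x $ j)))"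
proof -
  have "complex_of_real (sin (x $ j)) =
      (\<i> / 2) * cis (- (freq (axis j 1) \<bullet> x)) + (- \<i> / 2) * cis (- (freq (axis j (- 1)) \<bullet> x))" for x :: "real^3"
    by (simp add: freq_axis complex_eq_iff)
  then show ?thesis
    by (simp only:) (intro fourier_multiplier_add fourier_multiplier_mult
        fourier_multiplier_const fourier_multiplier_cis)
qed

lemma freq_0 [simp]: "freq 0 = 0"
  by (simp add: freq_eq_0_iff)

text \<open>Stone-Weierstrass approximates \<open>f\<close> uniformly on the range by some
  \<open>h\<close> that acts as a multiplier. The zeroth Fourier coefficient of the product of
  \<open>h\<close> and \<open>g\<close> is its integral, hence 0, and the error is at most
  \<open>e\<close> times the L^1 norm of \<open>g\<close>.\<close>

lemma integral_mult_torus_embed_eq_0: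
  assumes g: "integrable torus g" and null: "fcoeff g = (\<lambda>_. 0)"
    and f: "continuous_on (range torus_embed) f" "f \<in> borel_measurable borel"
  shows "(LINT x|torus. g x * f (torus_embed x)) = 0"
proof -
  have gnull: "fourier_null (\<lambda>x. complex_of_real (g x))"
    using g null by (auto simp: fourier_null_def fcoeff_def fun_eq_iff)
  \<comment> \<open>Continuity is asked only on the range, where the approximation takes place. It
    says nothing about \<open>h\<close> elsewhere, so Borel measurability is carried along
    separately.\<close>
  define P where "P h \<longleftrightarrow> continuous_on (range torus_embed) h \<and> h \<in> borel_measurable borel \<and>
      fourier_multiplier (\<lambda>x. complex_of_real (h (torus_embed x)))" for h :: "complex^3 \<Rightarrow> real"
  have f_int: "integrable torus (\<lambda>x. g x * h (torus_embed x))"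
    if "continuous_on (range torus_embed) h" and [measurable]: "h \<in> borel_measurable borel"
    for h :: "complex^3 \<Rightarrow> real"
  proof -
    have "bounded (h ` range torus_embed)"
      using that(1) compact_range_torus_embed compact_continuous_image compact_imp_bounded by blast
    then obtain B where B: "\<And>x. \<bar>h (torus_embed x)\<bar> \<le> B"
      unfolding bounded_real by blast
    have [measurable]: "g \<in> borel_measurable torus"
      using g by auto
    show ?thesis
    proof (rule Bochner_Integration.integrable_bound[where f = "\<lambda>x. B * g x"])
      show "AE x in torus. norm (g x * h (torus_embed x)) \<le> norm (B * g x)"
      proof (rule AE_I2)
        fix x
        have "\<bar>g x\<bar> * \<bar>h (torus_embed x)\<bar> \<le> \<bar>g x\<bar> * \<bar>B\<bar>"
          using B[of x] by (intro mult_left_mono) auto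
        then show "norm (g x * h (torus_embed x)) \<le> norm (B * g x)"
          by (simp add: abs_mult mult.commute)
      qed
    qed (use g in auto)
  qed
  have "\<bar>LINT x|torus. g x * f (torus_embed x)\<bar> \<le> e * (LINT x|torus. \<bar>g x\<bar>)" if e: "e > 0" for e
  proof -
    obtain h where h: "P h" "\<And>z. z \<in> range torus_embed \<Longrightarrow> \<bar>f z - h z\<bar> < e"
    proof (atomize_elim, rule Stone_Weierstrass_HOL[where P = P, simplified Ball_def, rule_format])
      fix z w assume zw: "z \<in> range torus_embed \<and> w \<in> range torus_embed \<and> z \<noteq> w"
      then obtain j where "z $ j \<noteq> w $ j" by (auto simp: vec_eq_iff)
      then consider "Re (z $ j) \<noteq> Re (w $ j)" | "Im (z $ j) \<noteq> Im (w $ j)"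
        by (auto simp: complex_eq_iff)
      then show "\<exists>f. P f \<and> f z \<noteq> f w"
      proof cases
        case 1
        have "P (\<lambda>z. Re (z $ j))"
          using fourier_multiplier_cos[of j] unfolding P_def
          by (auto simp: torus_embed_def intro!: continuous_intros borel_measurable_continuous_onI)
        with 1 show ?thesis by blast
      next
        case 2
        have "P (\<lambda>z. Im (z $ j))"
          using fourier_multiplier_sin[of j] unfolding P_def
          by (auto simp: torus_embed_def intro!: continuous_intros borel_measurable_continuous_onI)
        with 2 show ?thesis by blast
      qed
    qed (use e in \<open>auto simp: P_def fourier_multiplier_const fourier_multiplier_add fourier_multiplier_mult
        compact_range_torus_embed f intro!: continuous_intros\<close>)
    have int: "integrable torus (\<lambda>x. g x * h (torus_embed x))"
      using h(1) by (intro f_int) (auto simp: P_def)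
    have "fourier_null (\<lambda>x. complex_of_real (h (torus_embed x)) * complex_of_real (g x))"
      using h(1) gnull unfolding P_def fourier_multiplier_def by auto
    then have "(LINT x|torus. complex_of_real (g x * h (torus_embed x)) * cis (- (freq k \<bullet> x))) = 0" for k
      unfolding fourier_null_def by (auto simp: mult.commute)
    from this[of 0] have 0: "(LINT x|torus. g x * h (torus_embed x)) = 0"
      by (simp del: of_real_mult)
    have "(LINT x|torus. g x * f (torus_embed x)) =
        (LINT x|torus. g x * f (torus_embed x) - g x * h (torus_embed x))"
      using int f_int[OF f] 0 by simp
    also have "\<bar>\<dots>\<bar> \<le> (LINT x|torus. \<bar>g x * f (torus_embed x) - g x * h (torus_embed x)\<bar>)"
      by (rule integral_abs_bound)
    also have "\<dots> \<le> (LINT x|torus. e * \<bar>g x\<bar>)"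
    proof (rule integral_mono)
      fix x
      have "\<bar>g x\<bar> * \<bar>f (torus_embed x) - h (torus_embed x)\<bar> \<le> \<bar>g x\<bar> * e"
        using h(2)[of "torus_embed x"] by (intro mult_left_mono) auto
      then show "\<bar>g x * f (torus_embed x) - g x * h (torus_embed x)\<bar> \<le> e * \<bar>g x\<bar>"
        by (simp add: abs_mult mult.commute flip: right_diff_distrib)
    qed (use int f_int[OF f] g in auto)
    finally show ?thesis by simp
  qed
  note bound = this
  define I where "I = (LINT x|torus. \<bar>g x\<bar>)"
  have "I \<ge> 0" by (simp add: I_def)
  have "\<bar>LINT x|torus. g x * f (torus_embed x)\<bar> \<le> 0 + e" if "e > 0" for e
  proof -
    \<comment> \<open>Dividing by \<open>I + 1\<close> instead of \<open>I\<close> covers the case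
      \<open>I = 0\<close>.\<close>
    have "\<bar>LINT x|torus. g x * f (torus_embed x)\<bar> \<le> e / (I + 1) * I"
      unfolding I_def[symmetric] by (rule bound[folded I_def]) (use \<open>I \<ge> 0\<close> that in auto)
    also have "\<dots> \<le> e"
      using \<open>I \<ge> 0\<close> that by (simp add: field_simps)
    finally show ?thesis by simp
  qed
  then have "\<bar>LINT x|torus. g x * f (torus_embed x)\<bar> \<le> 0"
    by (rule field_le_epsilon)
  then show ?thesis by simp
qed

section \<open>From continuous test functions to Borel sets\<close>

text \<open>Off \<open>F\<close> the distance is positive, so the terms vanish once \<open>n\<close>
  exceeds its inverse. The empty set is excluded because \<open>infdist\<close> to it is 0 by
  convention, which would make every term 1.\<close>

lemma tendsto_indicator_infdist:
  assumes "closed F" "F \<noteq> {}"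
  shows "(\<lambda>n. max 0 (1 - real n * infdist z F)) \<longlonglongrightarrow> indicat_real F z"
proof (cases "z \<in> F")
  case False
  then have "infdist z F > 0"
    using assms in_closed_iff_infdist_zero[of F z] infdist_nonneg[of z F] by fastforce
  then obtain N :: nat where N: "1 / infdist z F < real N"
    using reals_Archimedean2 by blast
  have "max 0 (1 - real n * infdist z F) = 0" if "n \<ge> N" for n
  proof -
    have "1 / infdist z F < real n" using N that by simp
    then show ?thesis
      using \<open>infdist z F > 0\<close> by (simp add: field_simps)
  qed
  then have "eventually (\<lambda>n. max 0 (1 - real n * infdist z F) = indicat_real F z) sequentially"
    using False by (intro eventually_sequentiallyI[of N]) auto
  then show ?thesis by (rule tendsto_eventually)
qed simp

text \<open>The indicator of the compact image \<open>F\<close> of \<open>B\<close> is a limit of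
  continuous functions on the embedded torus. The preimage of \<open>F\<close> is the periodic
  extension of \<open>B\<close>; by injectivity it agrees with \<open>B\<close> on the open cell,
  that is, almost everywhere.\<close>

lemma set_integral_compact_eq_0:
  assumes g: "integrable torus g" and null: "fcoeff g = (\<lambda>_. 0)"
    and B: "compact B" "B \<subseteq> box 0 (\<chi> i. 2 * pi)"
  shows "(LINT x|torus. g x * indicator B x) = 0"
proof (cases "B = {}")
  case False
  define F where "F = torus_embed ` B"
  have F: "closed F" "F \<noteq> {}"
    using B False by (auto simp: F_def intro!: compact_imp_closed compact_continuous_image
        continuous_on_torus_embed)
  have [measurable]: "g \<in> borel_measurable torus" "F \<in> sets borel" "B \<in> sets borel"
    using g F B by (auto intro: borel_closed compact_imp_closed)
  have cont: "continuous_on A (\<lambda>z. max 0 (1 - real n * infdist z F))" for n A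
    by (intro continuous_intros)
  have [measurable]: "(\<lambda>z. max 0 (1 - real n * infdist z F)) \<in> borel_measurable borel" for n
    by (intro borel_measurable_continuous_onI cont)
  have "(\<lambda>n. LINT x|torus. g x * max 0 (1 - real n * infdist (torus_embed x) F))
      \<longlonglongrightarrow> (LINT x|torus. g x * indicator F (torus_embed x))"
  proof (rule integral_dominated_convergence[where w = "\<lambda>x. \<bar>g x\<bar>"])
    show "AE x in torus. norm (g x * max 0 (1 - real n * infdist (torus_embed x) F)) \<le> \<bar>g x\<bar>" for n
      by (auto simp: abs_mult infdist_nonneg intro!: mult_left_le)
    show "AE x in torus. (\<lambda>n. g x * max 0 (1 - real n * infdist (torus_embed x) F))
        \<longlonglongrightarrow> g x * indicator F (torus_embed x)"
      by (intro AE_I2 tendsto_mult tendsto_const tendsto_indicator_infdist F)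
  qed (use g in auto)
  moreover have "(LINT x|torus. g x * max 0 (1 - real n * infdist (torus_embed x) F)) = 0" for n
    using integral_mult_torus_embed_eq_0[OF g null cont] by simp
  ultimately have "(LINT x|torus. g x * indicator F (torus_embed x)) = 0"
    by (simp add: LIMSEQ_const_iff)
  moreover have "(LINT x|torus. g x * indicator F (torus_embed x)) = (LINT x|torus. g x * indicator B x)"
  proof (rule integral_cong_AE)
    show "AE x in torus. g x * indicator F (torus_embed x) = g x * indicator B x"
      using AE_torus_interior
    proof eventually_elim
      case (elim x)
      have "torus_embed x \<in> F \<longleftrightarrow> x \<in> B"
        unfolding F_def using inj_on_image_mem_iff[OF inj_on_torus_embed elim B(2)] .
      then show ?case by (simp add: indicator_def)
    qed
  qed auto
  ultimately show ?thesis by simp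
qed simp

text \<open>A closed set may reach the faces. Its intersections with slightly smaller cubes are
  compact subsets of the open cell, and dominated convergence recovers the whole set up to the null
  boundary.\<close>

lemma set_integral_closed_eq_0:
  assumes g: "integrable torus g" and null: "fcoeff g = (\<lambda>_. 0)" and A: "closed A"
  shows "(LINT x|torus. g x * indicator A x) = 0"
proof -
  \<comment> \<open>\<open>Suc n\<close> keeps the margin positive: as 1 / 0 = 0, the index
    \<open>n\<close> itself would give the full closed cell at 0.\<close>
  define K where "K n = cbox (\<chi> i. 1 / real (Suc n)) (\<chi> i. 2 * pi - 1 / real (Suc n) :: real^3)" for n
  have K: "compact (A \<inter> K n)" "A \<inter> K n \<subseteq> box 0 (\<chi> i. 2 * pi)" for n
  proof -
    show "compact (A \<inter> K n)"
      unfolding K_def by (intro closed_Int_compact A compact_cbox)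
    have "(0::real) < 1 / real (Suc n)" by simp
    then have "K n \<subseteq> box 0 (\<chi> i. 2 * pi)"
      unfolding K_def subset_iff mem_box_cart vec_lambda_beta zero_index by (smt (verit))
    then show "A \<inter> K n \<subseteq> box 0 (\<chi> i. 2 * pi)"
      by blast
  qed
  have [measurable]: "g \<in> borel_measurable torus" "A \<in> sets borel" "\<And>n. K n \<in> sets borel"
    using g A by (auto intro: borel_closed simp: K_def)
  have "(\<lambda>n. LINT x|torus. g x * indicator (A \<inter> K n) x) \<longlonglongrightarrow> (LINT x|torus. g x * indicator A x)"
  proof (rule integral_dominated_convergence[where w = "\<lambda>x. \<bar>g x\<bar>"])
    show "AE x in torus. norm (g x * indicator (A \<inter> K n) x) \<le> \<bar>g x\<bar>" for n
      by (auto simp: indicator_def)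
    show "AE x in torus. (\<lambda>n. g x * indicator (A \<inter> K n) x) \<longlonglongrightarrow> g x * indicator A x"
      using AE_torus_interior
    proof eventually_elim
      case (elim x)
      have "\<forall>\<^sub>F n in sequentially. 1 / real (Suc n) < x $ j \<and> 1 / real (Suc n) < 2 * pi - x $ j" for j
        using elim by (intro eventually_conj order_tendstoD(2)[OF LIMSEQ_Suc[OF lim_1_over_n]])
          (auto simp: mem_box_cart)
      then have "\<forall>\<^sub>F n in sequentially. \<forall>j. 1 / real (Suc n) < x $ j \<and> 1 / real (Suc n) < 2 * pi - x $ j"
        by (rule eventually_all_finite)
      then have "\<forall>\<^sub>F n in sequentially. g x * indicator (A \<inter> K n) x = g x * indicator A x"
      proof eventually_elim
        case (elim n)
        then have "x \<in> K n"
          by (simp add: K_def mem_box_cart less_imp_le) (smt (verit))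
        then show ?case by (simp add: indicator_def)
      qed
      then show ?case by (rule tendsto_eventually)
    qed
  qed (use g in auto)
  moreover have "(LINT x|torus. g x * indicator (A \<inter> K n) x) = 0" for n
    by (rule set_integral_compact_eq_0[OF g null K])
  ultimately show ?thesis by (simp add: LIMSEQ_const_iff)
qed

text \<open>A function with zero integral over every Borel set is null. Dynkin's theorem passes from
  closed sets, which are stable under intersection, to Borel sets; the step to complements uses that
  the whole space is closed, so that \<open>g\<close> itself has integral 0.\<close>

proposition fcoeff_eq_0_imp_AE_eq_0:
  assumes g: "integrable torus g" and null: "fcoeff g = (\<lambda>_. 0)"
  shows "AE x in torus. g x = 0"
proof (rule torus.density_zero[OF g])
  note [measurable] = borel_measurable_integrable[OF g]
  fix A assume "A \<in> sets torus"
  then have A: "A \<in> sigma_sets UNIV (Collect closed)"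
    by (simp add: borel_eq_closed)
  have "(LINT x|torus. g x * indicator A x) = 0"
  proof (rule sigma_sets_induct_disjoint[OF _ _ A, where P = "\<lambda>A. (LINT x|torus. g x * indicator A x) = 0"])
    show "Int_stable (Collect closed)"
      by (auto simp: Int_stable_def)
    show "(LINT x|torus. g x * indicator A x) = 0" if "A \<in> Collect closed" for A
      using that by (intro set_integral_closed_eq_0[OF g null]) simp
    show "(LINT x|torus. g x * indicator (UNIV - A) x) = 0"
      if "A \<in> sigma_sets UNIV (Collect closed)" and 0: "(LINT x|torus. g x * indicator A x) = 0" for A
    proof -
      have [measurable]: "A \<in> sets borel" using that by (simp add: borel_eq_closed)
      have "(LINT x|torus. g x * indicator (UNIV - A) x) = (LINT x|torus. g x - g x * indicator A x)"
        by (intro Bochner_Integration.integral_cong) (auto simp: indicator_def)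
      also have "\<dots> = (LINT x|torus. g x) - 0"
        using g 0 by (subst Bochner_Integration.integral_diff) (auto intro!: integrable_real_mult_indicator)
      also have "\<dots> = 0"
        using set_integral_closed_eq_0[OF g null, of UNIV] by simp
      finally show ?thesis .
    qed
    show "(LINT x|torus. g x * indicator (\<Union>i::nat. B i) x) = 0"
      if disj: "disjoint_family B" and B: "range B \<subseteq> sigma_sets UNIV (Collect closed)"
        and 0: "\<And>i. (LINT x|torus. g x * indicator (B i) x) = 0" for B
    proof -
      have [measurable]: "B i \<in> sets borel" for i using B by (auto simp: borel_eq_closed)
      have "set_integrable torus (\<Union>i. B i) g"
        unfolding set_integrable_def by (intro integrable_mult_indicator g sets.countable_UN) auto
      then have "(LINT x:(\<Union>i. B i)|torus. g x) = (\<Sum>i. LINT x:B i|torus. g x)"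
        using disj by (intro lebesgue_integral_countable_add) (auto simp: disjoint_family_on_def)
      then show ?thesis using 0 by (simp add: set_lebesgue_integral_def mult.commute)
    qed
  qed auto
  then show "set_lebesgue_integral torus A g = 0"
    by (simp add: set_lebesgue_integral_def mult.commute)
qed

section \<open>Completeness of the space of square-integrable functions\<close>

lemma integrable_square_add:
  fixes f g :: "'a \<Rightarrow> real"
  assumes [measurable]: "f \<in> borel_measurable M" "g \<in> borel_measurable M"
    and "integrable M (\<lambda>x. (f x)\<^sup>2)" "integrable M (\<lambda>x. (g x)\<^sup>2)"
  shows "integrable M (\<lambda>x. (f x + g x)\<^sup>2)"
proof (rule Bochner_Integration.integrable_bound)
  show "integrable M (\<lambda>x. 2 * (f x)\<^sup>2 + 2 * (g x)\<^sup>2)"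
    using assms by auto
  have "(f x + g x)\<^sup>2 \<le> 2 * (f x)\<^sup>2 + 2 * (g x)\<^sup>2" for x
    using zero_le_power2[of "f x - g x"] by (simp add: power2_eq_square algebra_simps)
  then show "AE x in M. norm ((f x + g x)\<^sup>2) \<le> norm (2 * (f x)\<^sup>2 + 2 * (g x)\<^sup>2)"
    by simp
qed simp

lemma integrable_square_diff:
  fixes f g :: "'a \<Rightarrow> real"
  assumes [measurable]: "f \<in> borel_measurable M" "g \<in> borel_measurable M"
    and "integrable M (\<lambda>x. (f x)\<^sup>2)" "integrable M (\<lambda>x. (g x)\<^sup>2)"
  shows "integrable M (\<lambda>x. (f x - g x)\<^sup>2)"
  using integrable_square_add[of f M "\<lambda>x. - g x"] assms by simp

lemma nn_integral_square:
  "integrable M (\<lambda>x. (f x :: real)\<^sup>2) \<Longrightarrow> (\<integral>\<^sup>+x. ennreal ((f x)\<^sup>2) \<partial>M) = ennreal (\<integral>x. (f x)\<^sup>2 \<partial>M)"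
  by (rule nn_integral_eq_integral) auto

lemma integrable_mult_of_square:
  fixes f g :: "'a \<Rightarrow> real"
  assumes [measurable]: "f \<in> borel_measurable M" "g \<in> borel_measurable M"
    and "integrable M (\<lambda>x. (f x)\<^sup>2)" "integrable M (\<lambda>x. (g x)\<^sup>2)"
  shows "integrable M (\<lambda>x. f x * g x)"
proof (rule Bochner_Integration.integrable_bound)
  show "integrable M (\<lambda>x. (f x)\<^sup>2 + (g x)\<^sup>2)"
    using assms by auto
  have "\<bar>f x * g x\<bar> \<le> (f x)\<^sup>2 + (g x)\<^sup>2" for x
  proof -
    have "2 * (\<bar>f x\<bar> * \<bar>g x\<bar>) \<le> (f x)\<^sup>2 + (g x)\<^sup>2"
      using sum_squares_bound[of "\<bar>f x\<bar>" "\<bar>g x\<bar>"] by (simp add: mult.assoc)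
    moreover have "0 \<le> \<bar>f x\<bar> * \<bar>g x\<bar>" by simp
    ultimately show ?thesis unfolding abs_mult by linarith
  qed
  then show "AE x in M. norm (f x * g x) \<le> norm ((f x)\<^sup>2 + (g x)\<^sup>2)"
    by (auto intro: order_trans)
qed simp

lemma Cauchy_Schwarz_integral:
  fixes f g :: "'a \<Rightarrow> real"
  assumes [measurable]: "f \<in> borel_measurable M" "g \<in> borel_measurable M"
    and int: "integrable M (\<lambda>x. (f x)\<^sup>2)" "integrable M (\<lambda>x. (g x)\<^sup>2)"
  shows "(\<integral>x. f x * g x \<partial>M) \<le> sqrt (\<integral>x. (f x)\<^sup>2 \<partial>M) * sqrt (\<integral>x. (g x)\<^sup>2 \<partial>M)"
proof -
  have "integrable M (\<lambda>x. \<bar>f x * g x\<bar>)"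
    using integrable_mult_of_square[OF assms] by simp
  then have "(\<integral>\<^sup>+x. ennreal \<bar>f x\<bar> * ennreal \<bar>g x\<bar> \<partial>M) = ennreal (\<integral>x. \<bar>f x * g x\<bar> \<partial>M)"
    by (subst nn_integral_eq_integral[symmetric]) (auto simp: abs_mult ennreal_mult)
  moreover have "(\<integral>\<^sup>+x. (ennreal \<bar>h x\<bar>)\<^sup>2 \<partial>M) = ennreal (\<integral>x. (h x)\<^sup>2 \<partial>M)"
    if "integrable M (\<lambda>x. (h x)\<^sup>2)" for h
    using nn_integral_square[OF that] by (simp add: ennreal_power)
  ultimately have "ennreal ((\<integral>x. \<bar>f x * g x\<bar> \<partial>M)\<^sup>2) \<le>
      ennreal ((\<integral>x. (f x)\<^sup>2 \<partial>M) * (\<integral>x. (g x)\<^sup>2 \<partial>M))"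
    using Cauchy_Schwarz_nn_integral[of "\<lambda>x. ennreal \<bar>f x\<bar>" M "\<lambda>x. ennreal \<bar>g x\<bar>"] int
    by (simp add: ennreal_power flip: ennreal_mult)
  then have "(\<integral>x. \<bar>f x * g x\<bar> \<partial>M)\<^sup>2 \<le> (\<integral>x. (f x)\<^sup>2 \<partial>M) * (\<integral>x. (g x)\<^sup>2 \<partial>M)"
    by (subst (asm) ennreal_le_iff) auto
  then have "(\<integral>x. \<bar>f x * g x\<bar> \<partial>M) \<le> sqrt (\<integral>x. (f x)\<^sup>2 \<partial>M) * sqrt (\<integral>x. (g x)\<^sup>2 \<partial>M)"
    by (simp add: real_le_rsqrt flip: real_sqrt_mult)
  moreover have "(\<integral>x. f x * g x \<partial>M) \<le> (\<integral>x. \<bar>f x * g x\<bar> \<partial>M)"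
    using integral_abs_bound[of M "\<lambda>x. f x * g x"] by linarith
  ultimately show ?thesis by simp
qed

lemma Minkowski_integral:
  fixes f g :: "'a \<Rightarrow> real"
  assumes [measurable]: "f \<in> borel_measurable M" "g \<in> borel_measurable M"
    and int: "integrable M (\<lambda>x. (f x)\<^sup>2)" "integrable M (\<lambda>x. (g x)\<^sup>2)"
  shows "sqrt (\<integral>x. (f x + g x)\<^sup>2 \<partial>M) \<le> sqrt (\<integral>x. (f x)\<^sup>2 \<partial>M) + sqrt (\<integral>x. (g x)\<^sup>2 \<partial>M)"
proof (rule real_le_lsqrt)
  have "(\<integral>x. (f x + g x)\<^sup>2 \<partial>M) = (\<integral>x. (f x)\<^sup>2 + (g x)\<^sup>2 + 2 * (f x * g x) \<partial>M)"
    by (simp add: power2_sum mult.assoc)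
  also have "\<dots> = (\<integral>x. (f x)\<^sup>2 \<partial>M) + (\<integral>x. (g x)\<^sup>2 \<partial>M) + 2 * (\<integral>x. f x * g x \<partial>M)"
    using int integrable_mult_of_square[OF assms] by simp
  also have "\<dots> \<le> (sqrt (\<integral>x. (f x)\<^sup>2 \<partial>M) + sqrt (\<integral>x. (g x)\<^sup>2 \<partial>M))\<^sup>2"
    using Cauchy_Schwarz_integral[OF assms] by (simp add: power2_sum)
  finally show "(\<integral>x. (f x + g x)\<^sup>2 \<partial>M) \<le> (sqrt (\<integral>x. (f x)\<^sup>2 \<partial>M) + sqrt (\<integral>x. (g x)\<^sup>2 \<partial>M))\<^sup>2" .
qed simp

text \<open>Each term is bounded by the total \<open>S\<close>, and 4^k is the square of 2^k, so the
  increments are at most \<open>sqrt S\<close> / 2^k and the telescoping series converges. The sum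
  is taken in \<open>ennreal\<close> because that is where integration of a series of nonnegative
  functions delivers it.\<close>

lemma Cauchy_if_geometric_square_sum:
  fixes a :: "nat \<Rightarrow> real"
  assumes fin: "(\<Sum>k. ennreal (4 ^ k * (a (Suc k) - a k)\<^sup>2)) \<noteq> \<infinity>"
  shows "convergent a"
proof -
  define S where "S = enn2real (\<Sum>k. ennreal (4 ^ k * (a (Suc k) - a k)\<^sup>2))"
  have bound: "norm (a (Suc k) - a k) \<le> sqrt S * (1 / 2) ^ k" for k
  proof -
    have "ennreal (4 ^ k * (a (Suc k) - a k)\<^sup>2) \<le> ennreal S"
      using fin sum_le_suminf[of "\<lambda>k. ennreal (4 ^ k * (a (Suc k) - a k)\<^sup>2)" "{k}"]
      by (simp add: S_def top.not_eq_extremum)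
    then have "4 ^ k * (a (Suc k) - a k)\<^sup>2 \<le> S"
      by (simp add: S_def)
    moreover have four: "(2 ^ k)\<^sup>2 = (4 :: real) ^ k"
      by (simp add: power2_eq_square flip: power_mult_distrib)
    ultimately have "(2 ^ k * \<bar>a (Suc k) - a k\<bar>)\<^sup>2 \<le> S"
      by (simp add: power_mult_distrib four)
    then have "2 ^ k * \<bar>a (Suc k) - a k\<bar> \<le> sqrt S"
      by (rule real_le_rsqrt)
    then show ?thesis by (simp add: field_simps)
  qed
  have "summable (\<lambda>k. sqrt S * (1 / 2) ^ k)"
    by (intro summable_mult summable_geometric) simp
  then have "summable (\<lambda>k. a (Suc k) - a k)"
    by (rule summable_comparison_test'[where N = 0]) (rule bound)
  then have "(\<lambda>n. a 0 + (\<Sum>k<n. a (Suc k) - a k)) \<longlonglongrightarrow> a 0 + (\<Sum>k. a (Suc k) - a k)"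
    by (intro tendsto_add tendsto_const summable_LIMSEQ)
  then show ?thesis
    unfolding sum_lessThan_telescope by (simp add: convergentI)
qed

text \<open>The limit is the pointwise limit of a rapidly converging subsequence. Fatou's lemma then
  carries the Cauchy estimates of the full sequence over to it.\<close>

theorem Riesz_Fischer:
  fixes u :: "nat \<Rightarrow> 'a \<Rightarrow> real"
  assumes meas [measurable]: "\<And>n. u n \<in> borel_measurable M"
    and int: "\<And>n. integrable M (\<lambda>x. (u n x)\<^sup>2)"
    and Cauchy: "\<And>e. e > 0 \<Longrightarrow> \<exists>N. \<forall>m\<ge>N. \<forall>n\<ge>N. (\<integral>x. (u m x - u n x)\<^sup>2 \<partial>M) < e"
  obtains f where "f \<in> borel_measurable M" "integrable M (\<lambda>x. (f x)\<^sup>2)"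
    "(\<lambda>n. \<integral>x. (u n x - f x)\<^sup>2 \<partial>M) \<longlonglongrightarrow> 0"
proof -
  have int_diff: "integrable M (\<lambda>x. (u m x - u n x)\<^sup>2)" for m n
    by (intro integrable_square_diff int meas)
  \<comment> \<open>The rate (1/8)^k compensates the weights 4^k and still leaves the summable
    (1/2)^k.\<close>
  have "\<forall>k. \<exists>N. \<forall>m\<ge>N. \<forall>n\<ge>N. (\<integral>x. (u m x - u n x)\<^sup>2 \<partial>M) < (1 / 8) ^ k"
    by (intro allI Cauchy) simp
  then obtain N where "\<forall>k. \<forall>m\<ge>N k. \<forall>n\<ge>N k. (\<integral>x. (u m x - u n x)\<^sup>2 \<partial>M) < (1 / 8) ^ k"
    by (rule choice[THEN exE])
  then have N: "(\<integral>x. (u m x - u n x)\<^sup>2 \<partial>M) < (1 / 8) ^ k" if "N k \<le> m" "N k \<le> n" for k m n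
    using that by simp
  \<comment> \<open>The chosen \<open>N\<close> need not be monotone. Partial sums make
    \<open>r\<close> increasing and at least \<open>N\<close>, and the added \<open>k\<close> makes
    it unbounded.\<close>
  define r where "r k = (\<Sum>i\<le>k. N i) + k" for k
  have rN: "N k \<le> r k" for k
    unfolding r_def using member_le_sum[of k "{..k}" N] by simp
  have r_mono: "r k \<le> r (Suc k)" for k by (simp add: r_def)
  have r_ge: "k \<le> r k" for k by (simp add: r_def)
  have "(\<integral>\<^sup>+x. (\<Sum>k. ennreal (4 ^ k * (u (r (Suc k)) x - u (r k) x)\<^sup>2)) \<partial>M) =
      (\<Sum>k. ennreal (4 ^ k * (\<integral>x. (u (r (Suc k)) x - u (r k) x)\<^sup>2 \<partial>M)))"
    by (subst nn_integral_suminf) (auto simp: ennreal_mult nn_integral_cmult nn_integral_square[OF int_diff])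
  also have "\<dots> \<le> (\<Sum>k. ennreal ((1 / 2) ^ k))"
  proof (intro suminf_le ennreal_leI)
    fix k
    have "(\<integral>x. (u (r (Suc k)) x - u (r k) x)\<^sup>2 \<partial>M) \<le> (1 / 8) ^ k"
      using N[of k "r (Suc k)" "r k"] rN[of k] r_mono[of k] by simp
    then have "4 ^ k * (\<integral>x. (u (r (Suc k)) x - u (r k) x)\<^sup>2 \<partial>M) \<le> 4 ^ k * (1 / 8) ^ k"
      by simp
    then show "4 ^ k * (\<integral>x. (u (r (Suc k)) x - u (r k) x)\<^sup>2 \<partial>M) \<le> (1 / 2) ^ k"
      by (simp flip: power_mult_distrib)
  qed auto
  also have "\<dots> = ennreal (\<Sum>k. (1 / 2) ^ k)"
    by (rule suminf_ennreal2) (auto intro: summable_geometric)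
  also have "\<dots> < \<infinity>" by simp
  finally have "AE x in M. (\<Sum>k. ennreal (4 ^ k * (u (r (Suc k)) x - u (r k) x)\<^sup>2)) \<noteq> \<infinity>"
    by (intro nn_integral_PInf_AE) auto
  then have conv: "AE x in M. convergent (\<lambda>k. u (r k) x)"
    by eventually_elim (rule Cauchy_if_geometric_square_sum)
  \<comment> \<open>Where the subsequence diverges, \<open>lim\<close> is an unspecified value; this
    concerns only a null set.\<close>
  define f where "f x = lim (\<lambda>k. u (r k) x)" for x
  have f [measurable]: "f \<in> borel_measurable M"
    unfolding f_def by measurable
  \<comment> \<open>Fatou's lemma along the subsequence, with \<open>n\<close> fixed.\<close>
  have bound: "(\<integral>\<^sup>+x. ennreal ((u n x - f x)\<^sup>2) \<partial>M) \<le> ennreal e"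
    if e: "\<And>m. N \<le> m \<Longrightarrow> (\<integral>x. (u n x - u m x)\<^sup>2 \<partial>M) \<le> e" for n N e
  proof -
    have "(\<integral>\<^sup>+x. ennreal ((u n x - f x)\<^sup>2) \<partial>M) =
        (\<integral>\<^sup>+x. liminf (\<lambda>k. ennreal ((u n x - u (r k) x)\<^sup>2)) \<partial>M)"
    proof (rule nn_integral_cong_AE, use conv in eventually_elim)
      case (elim x)
      then have "(\<lambda>k. ennreal ((u n x - u (r k) x)\<^sup>2)) \<longlonglongrightarrow> ennreal ((u n x - f x)\<^sup>2)"
        unfolding f_def by (intro tendsto_intros) (simp add: convergent_LIMSEQ_iff)
      then show ?case by (intro lim_imp_Liminf[symmetric]) auto
    qed
    also have "\<dots> \<le> liminf (\<lambda>k. \<integral>\<^sup>+x. ennreal ((u n x - u (r k) x)\<^sup>2) \<partial>M)"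
      by (rule nn_integral_liminf) auto
    also have "\<dots> \<le> limsup (\<lambda>k. \<integral>\<^sup>+x. ennreal ((u n x - u (r k) x)\<^sup>2) \<partial>M)"
      by (intro Liminf_le_Limsup) auto
    also have "\<dots> \<le> ennreal e"
    proof (rule Limsup_bounded, rule eventually_sequentiallyI)
      fix k assume "N \<le> k"
      then have "(\<integral>x. (u n x - u (r k) x)\<^sup>2 \<partial>M) \<le> e"
        using r_ge[of k] by (intro e) simp
      then show "(\<integral>\<^sup>+x. ennreal ((u n x - u (r k) x)\<^sup>2) \<partial>M) \<le> ennreal e"
        by (simp add: nn_integral_square[OF int_diff] ennreal_leI)
    qed
    finally show ?thesis .
  qed
  \<comment> \<open>A single index \<open>N0\<close> with finite distance to \<open>f\<close> is
    enough, since \<open>u n\<close> and \<open>u N0\<close> differ by a square-integrable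
    function.\<close>
  have int_f_diff: "integrable M (\<lambda>x. (u n x - f x)\<^sup>2)" for n
  proof -
    obtain N0 where N0: "\<And>m n. N0 \<le> m \<Longrightarrow> N0 \<le> n \<Longrightarrow> (\<integral>x. (u m x - u n x)\<^sup>2 \<partial>M) < 1"
      using Cauchy[of 1] by auto
    have "(\<integral>\<^sup>+x. ennreal ((u N0 x - f x)\<^sup>2) \<partial>M) \<le> ennreal 1"
      using N0 by (intro bound[of N0]) (auto intro: less_imp_le)
    then have "integrable M (\<lambda>x. (u N0 x - f x)\<^sup>2)"
      by (intro integrableI_bounded) (auto simp: less_top[symmetric] top_unique)
    then have "integrable M (\<lambda>x. ((u n x - u N0 x) + (u N0 x - f x))\<^sup>2)"
      using int_diff by (intro integrable_square_add) auto
    then show ?thesis by simp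
  qed
  show ?thesis
  proof (rule that[of f])
    show "integrable M (\<lambda>x. (f x)\<^sup>2)"
      using integrable_square_diff[OF _ _ int[of 0] int_f_diff[of 0]] by simp
    show "(\<lambda>n. \<integral>x. (u n x - f x)\<^sup>2 \<partial>M) \<longlonglongrightarrow> 0"
    proof (rule LIMSEQ_I)
      fix e :: real assume "e > 0"
      \<comment> \<open>Fatou's lemma yields only a weak inequality, so half of \<open>e\<close> is
        used to end with a strict one.\<close>
      then obtain N0 where N0: "\<And>m n. N0 \<le> m \<Longrightarrow> N0 \<le> n \<Longrightarrow> (\<integral>x. (u m x - u n x)\<^sup>2 \<partial>M) < e / 2"
        using Cauchy[of "e / 2"] by auto
      have "(\<integral>x. (u n x - f x)\<^sup>2 \<partial>M) < e" if "n \<ge> N0" for n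
      proof -
        have "ennreal (\<integral>x. (u n x - f x)\<^sup>2 \<partial>M) \<le> ennreal (e / 2)"
          using N0 that by (subst nn_integral_square[OF int_f_diff, symmetric], intro bound[of N0])
            (auto intro: less_imp_le)
        then show ?thesis using \<open>e > 0\<close> by (subst (asm) ennreal_le_iff) auto
      qed
      then show "\<exists>N0. \<forall>n\<ge>N0. norm ((\<integral>x. (u n x - f x)\<^sup>2 \<partial>M) - 0) < e"
        by auto
    qed
  qed simp
qed

section \<open>The spaces \<open>L\<^sup>2\<close> and \<open>H\<^sup>1\<close>\<close>

lemma L2_measurable: "u \<in> L2 \<Longrightarrow> u \<in> borel_measurable borel"
  and L2_square_integrable: "u \<in> L2 \<Longrightarrow> integrable torus (\<lambda>x. (u x)\<^sup>2)"
  by (auto simp: L2_def)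

lemma borel_measurable_torus [simp]: "borel_measurable torus = borel_measurable borel"
  by (rule measurable_cong_sets) auto

lemma L2_integrable: "u \<in> L2 \<Longrightarrow> integrable torus u"
  by (rule torus.square_integrable_imp_integrable) (auto simp: L2_def)

lemma L2_add: "u \<in> L2 \<Longrightarrow> w \<in> L2 \<Longrightarrow> (\<lambda>x. u x + w x) \<in> L2"
  using integrable_square_add[of u torus w] by (auto simp: L2_def)

lemma L2_diff: "u \<in> L2 \<Longrightarrow> w \<in> L2 \<Longrightarrow> (\<lambda>x. u x - w x) \<in> L2"
  using integrable_square_diff[of u torus w] by (auto simp: L2_def)

lemma L2_uminus: "u \<in> L2 \<Longrightarrow> (\<lambda>x. - u x) \<in> L2"
  by (auto simp: L2_def)

lemma L2_norm_nonneg [simp]: "0 \<le> L2_norm u"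
  by (simp add: L2_norm_def)

lemma L2_norm_uminus [simp]: "L2_norm (\<lambda>x. - u x) = L2_norm u"
  by (simp add: L2_norm_def)

lemma L2_norm_triangle:
  "u \<in> L2 \<Longrightarrow> w \<in> L2 \<Longrightarrow> L2_norm (\<lambda>x. u x + w x) \<le> L2_norm u + L2_norm w"
  unfolding L2_norm_def by (rule Minkowski_integral) (auto simp: L2_def)

lemma L2_norm_cong_AE:
  assumes "u \<in> borel_measurable borel" "w \<in> borel_measurable borel" "AE x in torus. u x = w x"
  shows "L2_norm u = L2_norm w"
proof -
  have "(LINT x|torus. (u x)\<^sup>2) = (LINT x|torus. (w x)\<^sup>2)"
    using assms by (intro integral_cong_AE) auto
  then show ?thesis by (simp add: L2_norm_def)
qed

lemma L2_norm_eq_0_iff: "u \<in> L2 \<Longrightarrow> L2_norm u = 0 \<longleftrightarrow> (AE x in torus. u x = 0)"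
  unfolding L2_norm_def
  using integral_nonneg_eq_0_iff_AE[OF L2_square_integrable, of u] by simp

lemma L2_bounded_mult:
  assumes [measurable]: "h \<in> borel_measurable borel" and B: "\<And>x. \<bar>h x\<bar> \<le> B" and u: "u \<in> L2"
  shows "(\<lambda>x. h x * u x) \<in> L2" "L2_norm (\<lambda>x. h x * u x) \<le> B * L2_norm u"
proof -
  have [measurable]: "u \<in> borel_measurable borel"
    using u by (rule L2_measurable)
  have "B \<ge> 0" using B[of 0] by linarith
  have le: "(h x * u x)\<^sup>2 \<le> B\<^sup>2 * (u x)\<^sup>2" for x
    unfolding power_mult_distrib using B[of x] \<open>B \<ge> 0\<close>
    by (intro mult_right_mono) (auto simp: abs_le_square_iff[symmetric])
  have int: "integrable torus (\<lambda>x. B\<^sup>2 * (u x)\<^sup>2)"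
    using u by (auto simp: L2_def)
  then have hu: "integrable torus (\<lambda>x. (h x * u x)\<^sup>2)"
    by (rule Bochner_Integration.integrable_bound) (auto simp: le)
  then show "(\<lambda>x. h x * u x) \<in> L2"
    by (simp add: L2_def)
  have "(LINT x|torus. (h x * u x)\<^sup>2) \<le> (LINT x|torus. B\<^sup>2 * (u x)\<^sup>2)"
    by (intro integral_mono hu int le)
  then have "L2_norm (\<lambda>x. h x * u x) \<le> sqrt (B\<^sup>2 * (LINT x|torus. (u x)\<^sup>2))"
    unfolding L2_norm_def by (intro real_sqrt_le_mono) simp
  then show "L2_norm (\<lambda>x. h x * u x) \<le> B * L2_norm u"
    using \<open>B \<ge> 0\<close> by (simp add: L2_norm_def real_sqrt_mult)
qed

text \<open>Cauchy-Schwarz against the constant 1, whose norm is 1 because the torus has mass 1.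
  This continuity is what lets weak derivatives pass to limits.\<close>

lemma norm_fcoeff_le:
  assumes "u \<in> L2"
  shows "norm (fcoeff u k) \<le> L2_norm u"
proof -
  have "norm (fcoeff u k) \<le> (LINT x|torus. norm (complex_of_real (u x) * cis (- (freq k \<bullet> x))))"
    unfolding fcoeff_def by (rule integral_norm_bound)
  also have "\<dots> = (LINT x|torus. \<bar>u x\<bar> * 1)"
    by (simp add: norm_mult)
  also have "\<dots> \<le> sqrt (LINT x|torus. \<bar>u x\<bar>\<^sup>2) * sqrt (LINT x|torus. 1\<^sup>2)"
    using assms by (intro Cauchy_Schwarz_integral) (auto simp: L2_def)
  also have "\<dots> = L2_norm u"
    using torus.prob_space by (simp add: L2_norm_def)
  finally show ?thesis .
qed

lemma L2_complete:
  assumes u: "\<And>n. u n \<in> L2"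
    and Cauchy: "\<And>e. e > 0 \<Longrightarrow> \<exists>N. \<forall>m\<ge>N. \<forall>n\<ge>N. L2_norm (\<lambda>x. u m x - u n x) < e"
  obtains f where "f \<in> L2" "(\<lambda>n. L2_norm (\<lambda>x. u n x - f x)) \<longlonglongrightarrow> 0"
proof -
  have "\<exists>N. \<forall>m\<ge>N. \<forall>n\<ge>N. (LINT x|torus. (u m x - u n x)\<^sup>2) < e" if "e > 0" for e
    using Cauchy[of "sqrt e"] that by (simp add: L2_norm_def)
  from Riesz_Fischer[of u torus, OF _ _ this] obtain f
    where "f \<in> borel_measurable torus" "integrable torus (\<lambda>x. (f x)\<^sup>2)"
    and lim: "(\<lambda>n. LINT x|torus. (u n x - f x)\<^sup>2) \<longlonglongrightarrow> 0"
    using u by (auto simp: L2_def)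
  then have "f \<in> L2" by (simp add: L2_def)
  moreover have "(\<lambda>n. L2_norm (\<lambda>x. u n x - f x)) \<longlonglongrightarrow> 0"
    unfolding L2_norm_def using tendsto_real_sqrt[OF lim] by simp
  ultimately show ?thesis by (rule that)
qed

section \<open>Linearity of Fourier coefficients and of weak derivatives\<close>

lemma fcoeff_uminus: "fcoeff (\<lambda>x. - u x) = (\<lambda>k. - fcoeff u k)"
  by (simp add: fcoeff_def fun_eq_iff)

lemma fcoeff_add:
  "integrable torus u \<Longrightarrow> integrable torus w \<Longrightarrow> fcoeff (\<lambda>x. u x + w x) = (\<lambda>k. fcoeff u k + fcoeff w k)"
  by (auto simp: fcoeff_def fun_eq_iff distrib_right integrable_mult_cis)

lemma fcoeff_diff:
  "integrable torus u \<Longrightarrow> integrable torus w \<Longrightarrow> fcoeff (\<lambda>x. u x - w x) = (\<lambda>k. fcoeff u k - fcoeff w k)"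
  using fcoeff_add[of u "\<lambda>x. - w x"] by (simp add: fcoeff_uminus)

lemma fcoeff_cong_AE:
  assumes [measurable]: "u \<in> borel_measurable borel" "w \<in> borel_measurable borel"
    and "AE x in torus. u x = w x"
  shows "fcoeff u = fcoeff w"
  unfolding fcoeff_def using assms(3) by (intro ext integral_cong_AE) auto

lemma is_weak_partial_unique:
  assumes "is_weak_partial j u g" "is_weak_partial j u h"
  shows "AE x in torus. g x = h x"
proof -
  have gh: "g \<in> L2" "h \<in> L2" "fcoeff g = fcoeff h"
    using assms by (auto simp: is_weak_partial_def)
  then have "fcoeff (\<lambda>x. g x - h x) = (\<lambda>_. 0)"
    by (simp add: fcoeff_diff L2_integrable)
  then have "AE x in torus. g x - h x = 0"
    using gh by (intro fcoeff_eq_0_imp_AE_eq_0) (auto intro: L2_integrable)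
  then show ?thesis by simp
qed

lemma is_weak_partial_uminus: "is_weak_partial j u g \<Longrightarrow> is_weak_partial j (\<lambda>x. - u x) (\<lambda>x. - g x)"
  by (auto simp: is_weak_partial_def L2_uminus fcoeff_uminus dpartial_def fun_eq_iff)

lemma is_weak_partial_add:
  "\<lbrakk>u \<in> L2; w \<in> L2; is_weak_partial j u g; is_weak_partial j w h\<rbrakk> \<Longrightarrow>
    is_weak_partial j (\<lambda>x. u x + w x) (\<lambda>x. g x + h x)"
  by (simp add: is_weak_partial_def L2_add fcoeff_add L2_integrable dpartial_def fun_eq_iff
      distrib_left)

lemma is_weak_partial_diff:
  "\<lbrakk>u \<in> L2; w \<in> L2; is_weak_partial j u g; is_weak_partial j w h\<rbrakk> \<Longrightarrow>
    is_weak_partial j (\<lambda>x. u x - w x) (\<lambda>x. g x - h x)"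
  using is_weak_partial_add[of u "\<lambda>x. - w x" j g "\<lambda>x. - h x"]
  by (simp add: L2_uminus is_weak_partial_uminus)

text \<open>\<open>weak_partial\<close> is a choice and need not be additive as a function.
  Almost-everywhere uniqueness makes its norm that of any weak derivative, which is how linearity of
  differentiation enters the norm estimates.\<close>

lemma L2_norm_weak_partial:
  assumes "is_weak_partial j u g"
  shows "L2_norm (weak_partial j u) = L2_norm g"
proof -
  have *: "is_weak_partial j u (weak_partial j u)"
    unfolding weak_partial_def by (rule someI[of "is_weak_partial j u", OF assms])
  show ?thesis
    by (rule L2_norm_cong_AE[OF _ _ is_weak_partial_unique[OF * assms]])
      (use * assms in \<open>auto simp: is_weak_partial_def L2_def\<close>)
qed

section \<open>Norm and completeness of the Sobolev space\<close>

lemma H1_weak_partial: "u \<in> H1 \<Longrightarrow> is_weak_partial j u (weak_partial j u)"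
  unfolding weak_partial_def by (rule someI_ex[of "is_weak_partial j u"]) (simp add: H1_def)

lemma H1_L2: "u \<in> H1 \<Longrightarrow> u \<in> L2"
  by (simp add: H1_def)

lemma H1_diff: "u \<in> H1 \<Longrightarrow> w \<in> H1 \<Longrightarrow> (\<lambda>x. u x - w x) \<in> H1"
  unfolding H1_def by (blast intro: L2_diff is_weak_partial_diff)

lemma H1_cong_AE:
  assumes "u \<in> H1" "w \<in> borel_measurable borel" "AE x in torus. w x = u x"
  shows "w \<in> H1"
proof -
  have u: "u \<in> L2" "u \<in> borel_measurable borel"
    using assms(1) by (auto simp: H1_def L2_def)
  have "integrable torus (\<lambda>x. (w x)\<^sup>2) = integrable torus (\<lambda>x. (u x)\<^sup>2)"
    using assms u by (intro integrable_cong_AE) auto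
  then have "w \<in> L2"
    using assms u by (simp add: L2_def)
  then show ?thesis
    using assms(1) fcoeff_cong_AE[OF assms(2) u(2) assms(3)] by (simp add: H1_def is_weak_partial_def)
qed

text \<open>Despite its name, \<open>L2_set\<close> is the Euclidean norm of a finite family. The
  norm is thus nested: functions, then the gradient as a vector, then a pair.\<close>

lemma H1_norm_L2_set:
  "H1_norm u = sqrt ((L2_norm u)\<^sup>2 + (L2_set (\<lambda>j. L2_norm (weak_partial j u)) UNIV)\<^sup>2)"
  by (simp add: H1_norm_def L2_set_def sum_nonneg)

lemma H1_norm_nonneg [simp]: "0 \<le> H1_norm u"
  by (simp add: H1_norm_def sum_nonneg)

lemma L2_norm_le_H1_norm: "L2_norm u \<le> H1_norm u"
  unfolding H1_norm_def by (intro real_le_rsqrt) (simp add: sum_nonneg)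

lemma L2_norm_weak_partial_le_H1_norm: "L2_norm (weak_partial j u) \<le> H1_norm u"
proof -
  have "(L2_norm (weak_partial j u))\<^sup>2 \<le> (\<Sum>j\<in>UNIV. (L2_norm (weak_partial j u))\<^sup>2)"
    by (intro member_le_sum) auto
  then show ?thesis
    unfolding H1_norm_def by (intro real_le_rsqrt) (simp add: add_increasing)
qed

text \<open>The predicate \<open>is_weak_partial j u\<close> depends on \<open>u\<close> only
  through \<open>fcoeff u\<close>, so \<open>weak_partial\<close> chooses literally the same
  function for both, even outside \<open>H1\<close>.\<close>

lemma H1_norm_cong_AE:
  assumes "u \<in> borel_measurable borel" "w \<in> borel_measurable borel" "AE x in torus. u x = w x"
  shows "H1_norm u = H1_norm w"
  using L2_norm_cong_AE[OF assms] fcoeff_cong_AE[OF assms]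
  by (simp add: H1_norm_def weak_partial_def is_weak_partial_def)

text \<open>
  No regularity is assumed: if \<open>u\<close> has no weak derivative then \<open>weak_partial j u\<close> and
  \<open>weak_partial j (- u)\<close> are the same arbitrary function.
\<close>

lemma H1_norm_uminus: "H1_norm (\<lambda>x. - u x) = H1_norm u"
proof -
  have "L2_norm (weak_partial j (\<lambda>x. - u x)) = L2_norm (weak_partial j u)" for j
  proof (cases "\<exists>g. is_weak_partial j u g")
    case True
    then obtain g where g: "is_weak_partial j u g" by blast
    show ?thesis
      using L2_norm_weak_partial[OF g] L2_norm_weak_partial[OF is_weak_partial_uminus[OF g]] by simp
  next
    case False
    moreover from this have "\<not> is_weak_partial j (\<lambda>x. - u x) g" for g
      using is_weak_partial_uminus[of j "\<lambda>x. - u x" g] by auto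
    ultimately have "is_weak_partial j (\<lambda>x. - u x) = is_weak_partial j u"
      by (auto simp: fun_eq_iff)
    then show ?thesis by (simp add: weak_partial_def)
  qed
  then show ?thesis by (simp add: H1_norm_def)
qed

text \<open>One triangle inequality for each level of nesting: Minkowski for the components, then
  \<open>L2_set\<close> for the gradient, then the plane.\<close>

lemma H1_norm_triangle:
  assumes "u \<in> H1" "w \<in> H1"
  shows "H1_norm (\<lambda>x. u x + w x) \<le> H1_norm u + H1_norm w"
proof -
  let ?D = "\<lambda>u. L2_set (\<lambda>j. L2_norm (weak_partial j u)) (UNIV :: 3 set)"
  have L2: "u \<in> L2" "w \<in> L2" and p: "is_weak_partial j u (weak_partial j u)"
    "is_weak_partial j w (weak_partial j w)" for j
    using assms by (auto intro: H1_L2 H1_weak_partial)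
  have "L2_norm (weak_partial j (\<lambda>x. u x + w x)) \<le>
      L2_norm (weak_partial j u) + L2_norm (weak_partial j w)" for j
    unfolding L2_norm_weak_partial[OF is_weak_partial_add[OF L2 p]]
    by (rule L2_norm_triangle) (use p in \<open>simp_all add: is_weak_partial_def\<close>)
  then have "?D (\<lambda>x. u x + w x) \<le> L2_set (\<lambda>j. L2_norm (weak_partial j u) + L2_norm (weak_partial j w)) UNIV"
    by (intro L2_set_mono) auto
  also have "\<dots> \<le> ?D u + ?D w"
    by (rule L2_set_triangle_ineq)
  finally have "H1_norm (\<lambda>x. u x + w x) \<le> sqrt ((L2_norm u + L2_norm w)\<^sup>2 + (?D u + ?D w)\<^sup>2)"
    unfolding H1_norm_L2_set using L2_norm_triangle[OF L2]
    by (intro real_sqrt_le_mono add_mono power_mono) auto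
  also have "\<dots> \<le> H1_norm u + H1_norm w"
    unfolding H1_norm_L2_set by (rule real_sqrt_sum_squares_triangle_ineq)
  finally show ?thesis .
qed

lemma H1_norm_0: "H1_norm (\<lambda>x. 0) = 0"
proof -
  have "is_weak_partial j (\<lambda>x. 0) (\<lambda>x. 0)" for j
    by (simp add: is_weak_partial_def L2_def dpartial_def fcoeff_def fun_eq_iff)
  from L2_norm_weak_partial[OF this] show ?thesis
    by (simp add: H1_norm_def L2_norm_def)
qed

lemma tendsto_fcoeff:
  assumes "\<And>n. u n \<in> L2" "f \<in> L2" "(\<lambda>n. L2_norm (\<lambda>x. u n x - f x)) \<longlonglongrightarrow> 0"
  shows "(\<lambda>n. fcoeff (u n) k) \<longlonglongrightarrow> fcoeff f k"
proof (rule LIM_zero_cancel, rule tendsto_norm_zero_cancel, rule tendsto_sandwich[OF _ _ tendsto_const assms(3)])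
  have "norm (fcoeff (u n) k - fcoeff f k) \<le> L2_norm (\<lambda>x. u n x - f x)" for n
    using norm_fcoeff_le[OF L2_diff[OF assms(1)[of n] assms(2)], of k] assms
    by (simp add: fcoeff_diff L2_integrable)
  then show "\<forall>\<^sub>F n in sequentially. norm (fcoeff (u n) k - fcoeff f k) \<le> L2_norm (\<lambda>x. u n x - f x)"
    by simp
qed simp

proposition H1_complete:
  assumes v: "\<And>n. v n \<in> H1"
    and Cauchy: "\<And>e. e > 0 \<Longrightarrow> \<exists>N. \<forall>m\<ge>N. \<forall>n\<ge>N. H1_norm (\<lambda>x. v m x - v n x) < e"
  obtains f where "f \<in> H1" "(\<lambda>n. H1_norm (\<lambda>x. v n x - f x)) \<longlonglongrightarrow> 0"
proof -
  have vL2: "v n \<in> L2" and vp: "is_weak_partial j (v n) (weak_partial j (v n))"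
    and pL2: "weak_partial j (v n) \<in> L2" for n j
    using v[of n] H1_weak_partial[of "v n" j] by (auto simp: H1_L2 is_weak_partial_def)
  obtain f where f: "f \<in> L2" "(\<lambda>n. L2_norm (\<lambda>x. v n x - f x)) \<longlonglongrightarrow> 0"
  proof (rule L2_complete[OF vL2])
    show "\<exists>N. \<forall>m\<ge>N. \<forall>n\<ge>N. L2_norm (\<lambda>x. v m x - v n x) < e" if "e > 0" for e
      using Cauchy[OF that] by (meson L2_norm_le_H1_norm le_less_trans)
  qed
  have "\<forall>j. \<exists>g. g \<in> L2 \<and> (\<lambda>n. L2_norm (\<lambda>x. weak_partial j (v n) x - g x)) \<longlonglongrightarrow> 0"
  proof
    fix j
    have le: "L2_norm (\<lambda>x. weak_partial j (v m) x - weak_partial j (v n) x) \<le>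
        H1_norm (\<lambda>x. v m x - v n x)" for m n
      using L2_norm_weak_partial[OF is_weak_partial_diff[OF vL2 vL2 vp vp]]
        L2_norm_weak_partial_le_H1_norm by metis
    have "\<exists>N. \<forall>m\<ge>N. \<forall>n\<ge>N. L2_norm (\<lambda>x. weak_partial j (v m) x - weak_partial j (v n) x) < e"
      if e: "e > 0" for e
    proof -
      obtain N where N: "\<And>m n. N \<le> m \<Longrightarrow> N \<le> n \<Longrightarrow> H1_norm (\<lambda>x. v m x - v n x) < e"
        using Cauchy[OF e] by blast
      show ?thesis
        by (intro exI[of _ N] allI impI le_less_trans[OF le] N)
    qed
    from L2_complete[OF pL2 this]
    show "\<exists>g. g \<in> L2 \<and> (\<lambda>n. L2_norm (\<lambda>x. weak_partial j (v n) x - g x)) \<longlonglongrightarrow> 0"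
      by blast
  qed
  from choice[OF this] obtain g where g: "\<And>j. g j \<in> L2"
    and g_lim: "\<And>j. (\<lambda>n. L2_norm (\<lambda>x. weak_partial j (v n) x - g j x)) \<longlonglongrightarrow> 0"
    by blast
  \<comment> \<open>At a fixed frequency differentiation is multiplication by a scalar, so both
    sides are limits of the same sequence of coefficients.\<close>
  have fg: "is_weak_partial j f (g j)" for j
    unfolding is_weak_partial_def
  proof (intro conjI g ext)
    fix k
    have "(\<lambda>n. fcoeff (weak_partial j (v n)) k) \<longlonglongrightarrow> fcoeff (g j) k"
      by (rule tendsto_fcoeff[OF pL2 g g_lim])
    moreover have "fcoeff (weak_partial j (v n)) k = \<i> * of_int (k $ j) * fcoeff (v n) k" for n
      using vp[of j n] by (simp add: is_weak_partial_def dpartial_def)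
    moreover have "(\<lambda>n. \<i> * of_int (k $ j) * fcoeff (v n) k) \<longlonglongrightarrow> \<i> * of_int (k $ j) * fcoeff f k"
      by (intro tendsto_mult tendsto_const tendsto_fcoeff[OF vL2 f])
    ultimately show "fcoeff (g j) k = dpartial j (fcoeff f) k"
      unfolding dpartial_def by (simp add: LIMSEQ_unique)
  qed
  have "f \<in> H1"
    using f fg by (auto simp: H1_def)
  moreover have "(\<lambda>n. H1_norm (\<lambda>x. v n x - f x)) \<longlonglongrightarrow> 0"
  proof -
    \<comment> \<open>Now that \<open>g j\<close> is known to be a derivative of \<open>f\<close>,
      the norms of the chosen derivatives of \<open>v n - f\<close> can be replaced by norms already
      known to tend to 0.\<close>
    have "H1_norm (\<lambda>x. v n x - f x) = sqrt ((L2_norm (\<lambda>x. v n x - f x))\<^sup>2 +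
        (\<Sum>j\<in>UNIV. (L2_norm (\<lambda>x. weak_partial j (v n) x - g j x))\<^sup>2))" for n
      unfolding H1_norm_def
      using L2_norm_weak_partial[OF is_weak_partial_diff[OF vL2 f(1) vp fg]] by simp
    moreover have "(\<lambda>n. sqrt ((L2_norm (\<lambda>x. v n x - f x))\<^sup>2 +
        (\<Sum>j\<in>UNIV. (L2_norm (\<lambda>x. weak_partial j (v n) x - g j x))\<^sup>2))) \<longlonglongrightarrow>
        sqrt (0\<^sup>2 + (\<Sum>j\<in>(UNIV :: 3 set). 0\<^sup>2))"
      by (intro tendsto_real_sqrt tendsto_add tendsto_sum tendsto_power f g_lim)
    ultimately show ?thesis by simp
  qed
  ultimately show ?thesis by (rule that)
qed

section \<open>Distributions of positive regularity\<close>

lemma finite_lattice_ball: "finite {k :: int^3. norm (freq k) \<le> R}"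
proof (rule finite_subset)
  let ?S = "{- \<lceil>R\<rceil>..\<lceil>R\<rceil>}"
  show "{k. norm (freq k) \<le> R} \<subseteq> vec_lambda ` (UNIV \<rightarrow>\<^sub>E ?S)"
  proof
    fix k assume "k \<in> {k. norm (freq k) \<le> R}"
    then have *: "\<bar>real_of_int (k $ i)\<bar> \<le> R" for i
      using component_le_norm_cart[of "freq k" i] by (simp add: freq_def)
    have "k $ i \<in> ?S" for i
      using *[of i] le_of_int_ceiling[of R] by (auto simp: abs_le_iff) linarith+
    then show "k \<in> vec_lambda ` (UNIV \<rightarrow>\<^sub>E ?S)"
      by (intro image_eqI[of _ _ "vec_nth k"]) auto
  qed
  show "finite (vec_lambda ` (UNIV \<rightarrow>\<^sub>E ?S))"
    by (intro finite_imageI finite_PiE) auto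
qed

lemma finite_lp_symbol_support:
  assumes "dyadic_partition \<theta> \<phi>"
  shows "finite {k. lp_symbol \<theta> \<phi> n (freq k) \<noteq> 0}"
proof (rule finite_subset[OF _ finite_lattice_ball])
  \<comment> \<open>One radius serves both kinds of block: 4/3 suffices for the block 0, and the
    block \<open>Suc m\<close> has scale 2^m, below 2^n.\<close>
  show "{k. lp_symbol \<theta> \<phi> n (freq k) \<noteq> 0} \<subseteq> {k. norm (freq k) \<le> 2 ^ n * (8 / 3)}"
  proof
    fix k assume k: "k \<in> {k. lp_symbol \<theta> \<phi> n (freq k) \<noteq> 0}"
    show "k \<in> {k. norm (freq k) \<le> 2 ^ n * (8 / 3)}"
    proof (cases n)
      case 0
      then have "\<theta> (freq k) \<noteq> 0" using k by (simp add: lp_symbol_def)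
      then have "norm (freq k) \<le> 4 / 3"
        using assms unfolding dyadic_partition_def by blast
      then show ?thesis using 0 by simp
    next
      case (Suc m)
      then have "\<phi> (freq k /\<^sub>R 2 ^ m) \<noteq> 0" using k by (simp add: lp_symbol_def)
      then have "norm (freq k /\<^sub>R 2 ^ m) \<le> 8 / 3"
        using assms unfolding dyadic_partition_def by blast
      then have "norm (freq k) \<le> 2 ^ m * (8 / 3)"
        by (simp add: field_simps)
      also have "\<dots> \<le> 2 ^ n * (8 / 3)"
        by (simp add: Suc)
      finally show ?thesis by simp
    qed
  qed
qed

text \<open>Since the symbol has finite support, the \<open>infsum\<close> in \<open>fseries\<close>
  is a trigonometric polynomial, whatever the growth of \<open>T\<close>.\<close>

lemma continuous_on_lp_block:
  assumes "dyadic_partition \<theta> \<phi>"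
  shows "continuous_on A (lp_block \<theta> \<phi> n T)"
proof -
  let ?S = "{k. lp_symbol \<theta> \<phi> n (freq k) \<noteq> 0}"
  have "lp_block \<theta> \<phi> n T =
      (\<lambda>x. \<Sum>k\<in>?S. of_real (lp_symbol \<theta> \<phi> n (freq k)) * T k * cis (freq k \<bullet> x))"
    unfolding lp_block_def fseries_def
    by (intro ext, subst infsum_finite[OF finite_lp_symbol_support[OF assms], symmetric],
        rule infsum_cong_neutral) auto
  then show ?thesis
    by (simp only:) (intro continuous_intros)
qed

lemma norm_lp_block_le:
  assumes "T \<in> besov \<theta> \<phi> \<alpha>"
  obtains C where "\<And>n x. norm (lp_block \<theta> \<phi> n T x) \<le> C * (2 powr - \<alpha>) ^ n"
proof -
  define C where "C = enn2real (besov_norm \<theta> \<phi> \<alpha> T)"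
  have "norm (lp_block \<theta> \<phi> n T x) \<le> C * (2 powr - \<alpha>) ^ n" for n x
  proof -
    have "ennreal (2 powr (\<alpha> * real n) * norm (lp_block \<theta> \<phi> n T x)) \<le>
        ennreal (2 powr (\<alpha> * real n)) * (SUP x. ennreal (norm (lp_block \<theta> \<phi> n T x)))"
      unfolding ennreal_mult'[OF powr_ge_zero] by (intro mult_left_mono SUP_upper) auto
    also have "\<dots> \<le> besov_norm \<theta> \<phi> \<alpha> T"
      unfolding besov_norm_def by (rule SUP_upper) simp
    also have "\<dots> = ennreal C"
      using assms by (simp add: C_def besov_def)
    finally have "2 powr (\<alpha> * real n) * norm (lp_block \<theta> \<phi> n T x) \<le> C"
      by (subst (asm) ennreal_le_iff) (auto simp: C_def)
    then have "norm (lp_block \<theta> \<phi> n T x) \<le> C * inverse (2 powr (\<alpha> * real n))"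
      by (simp add: field_simps)
    also have "inverse (2 powr (\<alpha> * real n)) = (2 powr - \<alpha>) ^ n"
      by (simp add: powr_powr flip: powr_minus powr_realpow)
    finally show ?thesis .
  qed
  then show ?thesis by (rule that)
qed

text \<open>For positive \<alpha> the bounds on the blocks form a geometric series of ratio below 1,
  and the Weierstrass M-test applies.\<close>

proposition lp_fun_continuous_bounded:
  assumes "dyadic_partition \<theta> \<phi>" "T \<in> besov \<theta> \<phi> \<alpha>" "\<alpha> > 0"
  shows "continuous_on UNIV (lp_fun \<theta> \<phi> T)" "bounded (range (lp_fun \<theta> \<phi> T))"
proof -
  obtain C where C: "\<And>n x. norm (lp_block \<theta> \<phi> n T x) \<le> C * (2 powr - \<alpha>) ^ n"
    using norm_lp_block_le[OF assms(2)] by blast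
  have "2 powr - \<alpha> < 1"
    using \<open>\<alpha> > 0\<close> by (simp add: powr_less_one)
  then have sum: "summable (\<lambda>n. C * (2 powr - \<alpha>) ^ n)"
    by (intro summable_mult summable_geometric) simp
  have "uniform_limit UNIV (\<lambda>N x. \<Sum>n<N. lp_block \<theta> \<phi> n T x)
      (\<lambda>x. \<Sum>n. lp_block \<theta> \<phi> n T x) sequentially"
    by (rule Weierstrass_m_test[OF C sum])
  then have "continuous_on UNIV (\<lambda>x. \<Sum>n. lp_block \<theta> \<phi> n T x)"
    by (rule uniform_limit_theorem[rotated])
      (auto intro!: continuous_on_sum continuous_on_lp_block assms always_eventually)
  then show "continuous_on UNIV (lp_fun \<theta> \<phi> T)"
    unfolding lp_fun_def by (intro continuous_intros)
  have "\<bar>lp_fun \<theta> \<phi> T x\<bar> \<le> (\<Sum>n. C * (2 powr - \<alpha>) ^ n)" for x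
  proof -
    have "\<bar>lp_fun \<theta> \<phi> T x\<bar> \<le> norm (\<Sum>n. lp_block \<theta> \<phi> n T x)"
      unfolding lp_fun_def by (rule abs_Re_le_cmod)
    also have "\<dots> \<le> (\<Sum>n. C * (2 powr - \<alpha>) ^ n)"
      by (rule norm_suminf_le[OF C sum])
    finally show ?thesis .
  qed
  then show "bounded (range (lp_fun \<theta> \<phi> T))"
    by (auto simp: bounded_real)
qed

section \<open>Closedness\<close>

text \<open>This removes classes and representatives from the problem, leaving conditions on
  functions. The assumption \<open>ge\<close> does double duty: it makes the norm nonnegative and
  makes classes at distance 0 equal.\<close>

lemma closed_formI:
  assumes sub: "form_dom F \<subseteq> L2"
    and diff: "\<And>u w. u \<in> form_dom F \<Longrightarrow> w \<in> form_dom F \<Longrightarrow> (\<lambda>x. u x - w x) \<in> form_dom F"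
    and cong: "\<And>u w. u \<in> form_dom F \<Longrightarrow> w \<in> borel_measurable borel \<Longrightarrow> AE x in torus. w x = u x \<Longrightarrow>
      w \<in> form_dom F \<and> form_norm F w = form_norm F u"
    and ge: "\<And>u. L2_norm u \<le> form_norm F u"
    and zero: "form_norm F (\<lambda>x. 0) = 0"
    and uminus: "\<And>u. form_norm F (\<lambda>x. - u x) = form_norm F u"
    and triangle: "\<And>u w. u \<in> form_dom F \<Longrightarrow> w \<in> form_dom F \<Longrightarrow>
      form_norm F (\<lambda>x. u x + w x) \<le> form_norm F u + form_norm F w"
    and complete: "\<And>u. \<lbrakk>\<And>n. u n \<in> form_dom F;
        \<And>e. e > 0 \<Longrightarrow> \<exists>N. \<forall>m\<ge>N. \<forall>n\<ge>N. form_norm F (\<lambda>x. u m x - u n x) < e\<rbrakk> \<Longrightarrow>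
      \<exists>f\<in>form_dom F. (\<lambda>n. form_norm F (\<lambda>x. u n x - f x)) \<longlonglongrightarrow> 0"
  shows "closed_form F"
proof -
  define C where "C = ae_class ` form_dom F"
  define d where "d A B = form_norm F (\<lambda>x. ae_rep A x - ae_rep B x)" for A B
  have nonneg: "0 \<le> form_norm F u" for u
    using ge[of u] L2_norm_nonneg[of u] by linarith
  have meas: "u \<in> borel_measurable borel" if "u \<in> form_dom F" for u
    using that sub by (auto simp: L2_def)
  have class_eq: "ae_class u = ae_class w" if "AE x in torus. u x = w x" for u w
  proof -
    have "(AE x in torus. v x = u x) \<longleftrightarrow> (AE x in torus. v x = w x)" for v
    proof
      assume "AE x in torus. v x = u x"
      with that show "AE x in torus. v x = w x" by eventually_elim simp
    next
      assume "AE x in torus. v x = w x"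
      with that show "AE x in torus. v x = u x" by eventually_elim simp
    qed
    then show ?thesis by (simp add: ae_class_def)
  qed
  have rep_AE: "ae_rep (ae_class u) \<in> form_dom F \<and> (AE x in torus. ae_rep (ae_class u) x = u x)"
    if "u \<in> form_dom F" for u
  proof -
    have "u \<in> ae_class u"
      using meas[OF that] by (simp add: ae_class_def)
    then have "ae_rep (ae_class u) \<in> ae_class u"
      unfolding ae_rep_def by (rule someI[of "\<lambda>w. w \<in> ae_class u"])
    then show ?thesis
      using cong[OF that] by (auto simp: ae_class_def)
  qed
  have rep: "ae_rep A \<in> form_dom F" and class_rep: "ae_class (ae_rep A) = A" if "A \<in> C" for A
    using that rep_AE class_eq unfolding C_def by auto
  have metric: "Metric_space C d"
  proof
    \<comment> \<open>\<open>Metric_space\<close> demands nonnegativity and symmetry for all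
      arguments, also outside \<open>C\<close>; this is why \<open>ge\<close> and
      \<open>uminus\<close> are not restricted to the domain.\<close>
    fix A B show "0 \<le> d A B"
      by (simp add: d_def nonneg)
    show "d A B = d B A"
      unfolding d_def using uminus[of "\<lambda>x. ae_rep A x - ae_rep B x"] by simp
  next
    fix A B assume AB: "A \<in> C" "B \<in> C"
    show "d A B = 0 \<longleftrightarrow> A = B"
    proof
      assume "d A B = 0"
      then have "L2_norm (\<lambda>x. ae_rep A x - ae_rep B x) = 0"
        using ge[of "\<lambda>x. ae_rep A x - ae_rep B x"] L2_norm_nonneg by (metis d_def order_antisym)
      then have "AE x in torus. ae_rep A x - ae_rep B x = 0"
        using AB rep diff sub by (subst (asm) L2_norm_eq_0_iff) blast+
      then have "ae_class (ae_rep A) = ae_class (ae_rep B)"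
        by (intro class_eq) simp
      then show "A = B" using AB by (simp add: class_rep)
    qed (simp add: d_def zero)
    fix E assume "E \<in> C"
    then show "d A E \<le> d A B + d B E"
      unfolding d_def
      using triangle[OF diff[OF rep[OF AB(1)] rep[OF AB(2)]] diff[OF rep[OF AB(2)] rep]] by simp
  qed
  interpret Metric_space C d by (rule metric)
  have "mcomplete"
    unfolding mcomplete_def
  proof (intro allI impI)
    fix \<sigma> assume \<sigma>: "MCauchy \<sigma>"
    then have C: "\<sigma> n \<in> C" for n by (auto simp: MCauchy_def)
    have "\<exists>N. \<forall>m\<ge>N. \<forall>n\<ge>N. form_norm F (\<lambda>x. ae_rep (\<sigma> m) x - ae_rep (\<sigma> n) x) < e" if "e > 0" for e
    proof -
      have "\<exists>N. \<forall>m n. N \<le> m \<longrightarrow> N \<le> n \<longrightarrow> d (\<sigma> m) (\<sigma> n) < e"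
        using \<sigma> that by (simp add: MCauchy_def)
      then obtain N where "\<forall>m n. N \<le> m \<longrightarrow> N \<le> n \<longrightarrow> d (\<sigma> m) (\<sigma> n) < e" ..
      then show ?thesis
        by (intro exI[of _ N]) (simp add: d_def)
    qed
    from complete[OF rep[OF C] this] obtain f where f: "f \<in> form_dom F"
      and lim: "(\<lambda>n. form_norm F (\<lambda>x. ae_rep (\<sigma> n) x - f x)) \<longlonglongrightarrow> 0"
      by blast
    \<comment> \<open>The limit \<open>f\<close> need not be the representative chosen for its own
      class; \<open>cong\<close> absorbs the difference.\<close>
    have "d (\<sigma> n) (ae_class f) = form_norm F (\<lambda>x. ae_rep (\<sigma> n) x - f x)" for n
    proof -
      have r: "ae_rep (ae_class f) \<in> form_dom F" "AE x in torus. ae_rep (ae_class f) x = f x"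
        using rep_AE[OF f] by auto
      have "AE x in torus. ae_rep (\<sigma> n) x - ae_rep (ae_class f) x = ae_rep (\<sigma> n) x - f x"
        using r(2) by eventually_elim simp
      then show ?thesis
        unfolding d_def using cong[OF diff[OF rep[OF C] f] meas[OF diff[OF rep[OF C] r(1)]]] by blast
    qed
    moreover have "ae_class f \<in> C"
      using f by (simp add: C_def)
    ultimately have "limitin mtopology \<sigma> (ae_class f) sequentially"
      using lim C by (simp add: limitin_metric_dist_null)
    then show "\<exists>A. limitin mtopology \<sigma> A sequentially" ..
  qed
  then show ?thesis
    unfolding closed_form_def Let_def using metric sub by (simp add: C_def d_def[abs_def])
qed

text \<open>The deterministic core, for a fixed bounded Borel function \<open>W\<close>: the form
  norm of \<open>u\<close> and the H^1 norm of e^(-W) \<open>u\<close> are equivalent.\<close>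

proposition closed_form_anderson_form:
  assumes W: "W = (\<lambda>x. lp_fun \<theta> \<phi> X x + lp_fun \<theta> \<phi> (poisson XX) x)"
    and [measurable]: "W \<in> borel_measurable borel" and bdd: "bounded (range W)"
  shows "closed_form (anderson_form \<theta> \<phi> X xi0 XX YY XY)"
proof -
  let ?F = "anderson_form \<theta> \<phi> X xi0 XX YY XY"
  let ?V = "\<lambda>u x. exp (- W x) * u x"
  obtain B where B: "\<And>x. \<bar>W x\<bar> \<le> B"
    using bdd by (auto simp: bounded_real)
  have dom: "form_dom ?F = (\<lambda>v x. exp (W x) * v x) ` H1"
    and nrm: "form_norm ?F u = sqrt ((L2_norm u)\<^sup>2 + (H1_norm (?V u))\<^sup>2)" for u
    by (simp_all add: anderson_form_def W Let_def)
  have inv: "exp (W x) * (exp (- W x) * c) = c" "exp (- W x) * (exp (W x) * c) = c" for x c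
    by (simp_all add: mult.assoc[symmetric] exp_minus_inverse exp_minus)
  \<comment> \<open>Membership is restated without the image, so that the linear structure of
    \<open>H1\<close> transfers to the domain directly.\<close>
  have mem: "u \<in> form_dom ?F \<longleftrightarrow> ?V u \<in> H1" for u
  proof
    assume "?V u \<in> H1"
    then have "(\<lambda>x. exp (W x) * ?V u x) \<in> form_dom ?F"
      unfolding dom by (rule imageI)
    then show "u \<in> form_dom ?F" by (simp add: inv)
  qed (auto simp: dom inv)
  have exp_le: "\<bar>exp (W x)\<bar> \<le> exp B" for x
    using B[of x] by simp
  have sub: "form_dom ?F \<subseteq> L2"
    unfolding dom by (auto intro!: L2_bounded_mult(1)[OF _ exp_le] dest: H1_L2)
  show ?thesis
  proof (rule closed_formI[OF sub])
    fix u w assume uw: "u \<in> form_dom ?F" "w \<in> form_dom ?F"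
    show "(\<lambda>x. u x - w x) \<in> form_dom ?F"
      using uw H1_diff[of "?V u" "?V w"] by (simp add: mem right_diff_distrib)
    have "H1_norm (?V (\<lambda>x. u x + w x)) \<le> H1_norm (?V u) + H1_norm (?V w)"
      using uw H1_norm_triangle[of "?V u" "?V w"] by (simp add: mem distrib_left)
    moreover have "L2_norm (\<lambda>x. u x + w x) \<le> L2_norm u + L2_norm w"
      using uw sub by (intro L2_norm_triangle) auto
    ultimately have "form_norm ?F (\<lambda>x. u x + w x) \<le>
        sqrt ((L2_norm u + L2_norm w)\<^sup>2 + (H1_norm (?V u) + H1_norm (?V w))\<^sup>2)"
      unfolding nrm by (intro real_sqrt_le_mono add_mono power_mono) auto
    also have "\<dots> \<le> form_norm ?F u + form_norm ?F w"
      unfolding nrm by (rule real_sqrt_sum_squares_triangle_ineq)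
    finally show "form_norm ?F (\<lambda>x. u x + w x) \<le> form_norm ?F u + form_norm ?F w" .
  next
    fix u w assume u: "u \<in> form_dom ?F" and w [measurable]: "w \<in> borel_measurable borel"
      and eq: "AE x in torus. w x = u x"
    have [measurable]: "u \<in> borel_measurable borel"
      using u sub by (auto simp: L2_def)
    have V: "?V w \<in> borel_measurable borel" "?V u \<in> borel_measurable borel"
      "AE x in torus. ?V w x = ?V u x"
      using eq by auto
    show "w \<in> form_dom ?F \<and> form_norm ?F w = form_norm ?F u"
      using H1_cong_AE[OF _ V(1,3)] H1_norm_cong_AE[OF V] u L2_norm_cong_AE[OF _ _ eq]
      by (simp add: mem nrm)
  next
    fix u show "L2_norm u \<le> form_norm ?F u"
      unfolding nrm by (intro real_le_rsqrt) simp
    show "form_norm ?F (\<lambda>x. - u x) = form_norm ?F u"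
      using H1_norm_uminus[of "?V u"] by (simp add: nrm)
  next
    show "form_norm ?F (\<lambda>x. 0) = 0"
      by (simp add: nrm H1_norm_0 L2_norm_def)
  next
    fix u :: "nat \<Rightarrow> real^3 \<Rightarrow> real"
    assume u: "\<And>n. u n \<in> form_dom ?F"
      and Cauchy: "\<And>e. e > 0 \<Longrightarrow> \<exists>N. \<forall>m\<ge>N. \<forall>n\<ge>N. form_norm ?F (\<lambda>x. u m x - u n x) < e"
    have H1_le: "H1_norm (\<lambda>x. ?V (u m) x - ?V (u n) x) \<le> form_norm ?F (\<lambda>x. u m x - u n x)" for m n
      unfolding nrm right_diff_distrib by (intro real_le_rsqrt) simp
    obtain f where f: "f \<in> H1" and lim: "(\<lambda>n. H1_norm (\<lambda>x. ?V (u n) x - f x)) \<longlonglongrightarrow> 0"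
    proof (rule H1_complete)
      show "?V (u n) \<in> H1" for n
        using u[of n] by (simp add: mem)
      show "\<exists>N. \<forall>m\<ge>N. \<forall>n\<ge>N. H1_norm (\<lambda>x. ?V (u m) x - ?V (u n) x) < e" if "e > 0" for e
        using Cauchy[OF that] H1_le by (meson le_less_trans)
    qed
    \<comment> \<open>The H^1 limit is transported back. What remains is convergence in the form
      norm, whose L^2 part is not contained in the H^1 limit and costs the factor
      \<open>exp B\<close>.\<close>
    define g where "g = (\<lambda>x. exp (W x) * f x)"
    have g: "g \<in> form_dom ?F"
      unfolding dom g_def using f by blast
    have V: "?V (\<lambda>x. u n x - g x) = (\<lambda>x. ?V (u n) x - f x)" for n
      by (simp add: g_def right_diff_distrib inv)
    have "L2_norm (\<lambda>x. u n x - g x) \<le> exp B * H1_norm (\<lambda>x. ?V (u n) x - f x)" for n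
    proof -
      have "?V (u n) \<in> H1" using u[of n] by (simp add: mem)
      then have "(\<lambda>x. ?V (u n) x - f x) \<in> L2"
        using f by (intro H1_L2 H1_diff)
      then have "L2_norm (\<lambda>x. exp (W x) * (?V (u n) x - f x)) \<le>
          exp B * L2_norm (\<lambda>x. ?V (u n) x - f x)"
        by (intro L2_bounded_mult exp_le) auto
      then have "L2_norm (\<lambda>x. u n x - g x) \<le> exp B * L2_norm (\<lambda>x. ?V (u n) x - f x)"
        by (simp add: right_diff_distrib inv g_def)
      also have "\<dots> \<le> exp B * H1_norm (\<lambda>x. ?V (u n) x - f x)"
        by (simp add: L2_norm_le_H1_norm)
      finally show ?thesis .
    qed
    then have le: "form_norm ?F (\<lambda>x. u n x - g x) \<le>
        sqrt ((exp B * H1_norm (\<lambda>x. ?V (u n) x - f x))\<^sup>2 + (H1_norm (\<lambda>x. ?V (u n) x - f x))\<^sup>2)" for n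
      unfolding nrm V by (intro real_sqrt_le_mono add_mono power_mono) auto
    have "(\<lambda>n. sqrt ((exp B * H1_norm (\<lambda>x. ?V (u n) x - f x))\<^sup>2 +
        (H1_norm (\<lambda>x. ?V (u n) x - f x))\<^sup>2)) \<longlonglongrightarrow> sqrt ((exp B * 0)\<^sup>2 + 0\<^sup>2)"
      by (intro tendsto_real_sqrt tendsto_add tendsto_power tendsto_mult tendsto_const lim)
    then have lim_bound: "(\<lambda>n. sqrt ((exp B * H1_norm (\<lambda>x. ?V (u n) x - f x))\<^sup>2 +
        (H1_norm (\<lambda>x. ?V (u n) x - f x))\<^sup>2)) \<longlonglongrightarrow> 0"
      by simp
    have nonneg: "0 \<le> form_norm ?F w" for w
      by (simp add: nrm)
    have "(\<lambda>n. form_norm ?F (\<lambda>x. u n x - g x)) \<longlonglongrightarrow> 0"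
      by (rule tendsto_sandwich[OF always_eventually always_eventually tendsto_const lim_bound])
        (intro allI nonneg le)+
    then show "\<exists>f\<in>form_dom ?F. (\<lambda>n. form_norm ?F (\<lambda>x. u n x - f x)) \<longlonglongrightarrow> 0"
      using g by (rule bexI)
  qed
qed

theorem proposition3p3:
  fixes M :: "'w measure"
    and \<xi> :: "int^3 \<Rightarrow> 'w \<Rightarrow> complex"
    and \<theta> \<phi> \<rho> :: "real^3 \<Rightarrow> real"
    and XX YY XY :: "'w \<Rightarrow> distr3"
  assumes "prob_space M"
    and "white_noise M \<xi>"
    and "dyadic_partition \<theta> \<phi>"
    and "mollifier \<rho>"
    and X_regularity: "AE \<omega> in M. \<forall>\<kappa>>0. X_field \<xi> \<omega> \<in> besov \<theta> \<phi> (1 / 2 - \<kappa>)"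
    and XX_limit: "\<And>\<kappa>. \<kappa> > 0 \<Longrightarrow> besov_limit_in_prob \<theta> \<phi> M (- 1 - 2 * \<kappa>)
           (\<lambda>\<epsilon>. centered_grad_sq M (X_eps \<rho> \<xi> \<epsilon>)) XX"
    and Y_regularity: "AE \<omega> in M. \<forall>\<kappa>>0. poisson (XX \<omega>) \<in> besov \<theta> \<phi> (1 - \<kappa>)"
    and YY_limit: "\<And>\<kappa>. \<kappa> > 0 \<Longrightarrow> besov_limit_in_prob \<theta> \<phi> M (- 4 * \<kappa>)
           (\<lambda>\<epsilon>. centered_grad_sq M (Y_eps \<rho> \<xi> \<epsilon>)) YY"
    and XY_limit: "\<And>\<kappa>. \<kappa> > 0 \<Longrightarrow> besov_limit_in_prob \<theta> \<phi> M (- 1 / 2 - 3 * \<kappa>)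
           (\<lambda>\<epsilon> \<omega>. fcoeff (grad_dot (X_eps \<rho> \<xi> \<epsilon> \<omega>) (Y_eps \<rho> \<xi> \<epsilon> \<omega>))) XY"
  shows "AE \<omega> in M. closed_form
           (anderson_form \<theta> \<phi> (X_field \<xi> \<omega>) (Re (\<xi> 0 \<omega>)) (XX \<omega>) (YY \<omega>) (XY \<omega>))"
proof -
  show ?thesis
    using X_regularity Y_regularity
  proof eventually_elim
    case (elim \<omega>)
    let ?X = "lp_fun \<theta> \<phi> (X_field \<xi> \<omega>)" and ?Y = "lp_fun \<theta> \<phi> (poisson (XX \<omega>))"
    \<comment> \<open>Any \<kappa> leaving a positive exponent would do: 1/4 for X leaves 1/4, and
      1/2 for Y leaves 1/2.\<close>
    have X: "X_field \<xi> \<omega> \<in> besov \<theta> \<phi> (1 / 2 - 1 / 4)"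
      using elim(1) by (meson zero_less_divide_1_iff zero_less_numeral)
    have Y: "poisson (XX \<omega>) \<in> besov \<theta> \<phi> (1 - 1 / 2)"
      using elim(2) by (meson zero_less_divide_1_iff zero_less_numeral)
    note XY = lp_fun_continuous_bounded[OF \<open>dyadic_partition \<theta> \<phi>\<close> X]
      lp_fun_continuous_bounded[OF \<open>dyadic_partition \<theta> \<phi>\<close> Y]
    show ?case
    proof (rule closed_form_anderson_form[OF refl])
      show "(\<lambda>x. ?X x + ?Y x) \<in> borel_measurable borel"
        using XY by (intro borel_measurable_continuous_onI continuous_on_add) auto
      show "bounded (range (\<lambda>x. ?X x + ?Y x))"
        using XY by (intro bounded_plus_comp) auto
    qed
  qed
qed

end
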